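(* There is a constant $C=C(n)>0$, depending only on $n$, such that for all $x_0\in\mathbb R^n$, $r>0$, $a>0$, $T>0$, all $u_0\in C_0^\infty(\mathbb R^n;\mathbb C)$ and all $\varepsilon\in(0,1)$, $$\int_{\mathbb R^n}|u_0(x)|^2\,dx\le C(x_0,r,a,T)\Big(\varepsilon\Big(\int_{\mathbb R^n}e^{a|x|}|u_0(x)|^2\,dx+\|u_0\|^2_{H^{n+3}(\mathbb R^n;\mathbb C)}\Big)+\varepsilon e^{e^{\varepsilon^{-2}}}\int_{B_r(x_0)}|u(x,T;u_0)|^2\,dx\Big),$$ where $$C(x_0,r,a,T)=(1+T)^{2n+6}\exp\Big\{C^{\,1+\frac{|x_0|+r+1}{(aT)\wedge r}}\Big\}.$$
   Context: Here $n\in\{1,2,\dots\}$ is fixed. For $u_0\in L^2(\mathbb R^n;\mathbb C)$ and $t\ge 0$, $u(x,t;u_0)=(e^{i\Delta t}u_0)(x)$ denotes the solution of the free Schrödinger equation $i\partial_t u+\Delta u=0$ in $\mathbb R^n\times(0,\infty)$ with $u(x,0)=u_0(x)$. $B_r(x)$ is the closed ball in $\mathbb R^n$ centered at $x$ of radius $r$. $|x|$ is the Euclidean norm, $a\wedge b=\min\{a,b\}$, and $\|\cdot\|_{H^{n+3}}$ is the standard $L^2$-based Sobolev norm of order $n+3$. *)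

theory Defs
  imports "HOL-Analysis.Analysis"
begin

(* On a finite-dimensional domain this is the usual notion: all partial derivatives of order
   at most k exist and are continuous. *)
primrec C_k :: "nat \<Rightarrow> ('a::real_normed_vector \<Rightarrow> 'b::real_normed_vector) \<Rightarrow> bool" where
  "C_k 0 f \<longleftrightarrow> continuous_on UNIV f"
| "C_k (Suc k) f \<longleftrightarrow>
     (\<forall>x. f differentiable (at x)) \<and> (\<forall>v. C_k k (\<lambda>x. frechet_derivative f (at x) v))"

definition test_functions :: "(real^'n \<Rightarrow> complex) set" where
  "test_functions = {f. (\<forall>k. C_k k f) \<and> compact (closure {x. f x \<noteq> 0})}"

(* Unitary normalisation: the transform extends to an isometry of L^2. *)
definition fourier :: "(real^'n \<Rightarrow> complex) \<Rightarrow> real^'n \<Rightarrow> complex" where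
  "fourier f \<xi> =
     (1 / (2 * pi) powr (real CARD('n) / 2)) *\<^sub>R (\<integral>x. cis (- (x \<bullet> \<xi>)) * f x \<partial>lborel)"

definition inverse_fourier :: "(real^'n \<Rightarrow> complex) \<Rightarrow> real^'n \<Rightarrow> complex" where
  "inverse_fourier g x =
     (1 / (2 * pi) powr (real CARD('n) / 2)) *\<^sub>R (\<integral>\<xi>. cis (x \<bullet> \<xi>) * g \<xi> \<partial>lborel)"

(* The unitary group generated by i times the Laplacian: the Laplacian is the Fourier multiplier
   with symbol - |xi|^2, so its exponential has symbol exp (- i t |xi|^2). The integrals are
   Lebesgue integrals, so this is the pointwise solution of i u_t + Lap u = 0, u(0) = f, when f and
   its transform are integrable (in particular for test functions); the extension to all of
   L^2 by density is not needed. *)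
definition schroedinger_group :: "real \<Rightarrow> (real^'n \<Rightarrow> complex) \<Rightarrow> real^'n \<Rightarrow> complex" where
  "schroedinger_group t f = inverse_fourier (\<lambda>\<xi>. cis (- t * (norm \<xi>)\<^sup>2) * fourier f \<xi>)"

definition sobolev_norm :: "nat \<Rightarrow> (real^'n \<Rightarrow> complex) \<Rightarrow> real" where
  "sobolev_norm k f = sqrt (\<integral>\<xi>. (1 + (norm \<xi>)\<^sup>2) ^ k * (cmod (fourier f \<xi>))\<^sup>2 \<partial>lborel)"

(* The constant C(x0, r, a, T); the parameter K is the constant C = C(n) inside it. *)
definition obs_const :: "real \<Rightarrow> real^'n \<Rightarrow> real \<Rightarrow> real \<Rightarrow> real \<Rightarrow> real" where
  "obs_const K x0 r a T =
     (1 + T) ^ (2 * CARD('n) + 6) * exp (K powr (1 + (norm x0 + r + 1) / min (a * T) r))"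

end

theory Submission
  imports Defs "HOL-Probability.Characteristic_Functions" "HOL-Probability.Sinc_Integral"
    "HOL-Complex_Analysis.Conformal_Mappings"
begin

text \<open>
  Completing the square in the Schroedinger kernel shows that, up to a factor of modulus one and a
  dilation, the evolution is a Fourier transform:
  \<open>|u(x,T)| = (4 \<pi> T) powr (- n/2) |\<integral> exp(- i x \<bullet> y / (2 T)) g(y) dy|\<close> with the chirped datum
  \<open>g(y) = exp(i |y|\<^sup>2 / (4 T)) u\<^sub>0(y)\<close> (lemma \<open>cmod_schroedinger_group\<close>). If \<open>u\<^sub>0\<close> has the exponential weight
  \<open>exp(a |y|)\<close>, this transform is analytic with length scale \<open>\<rho> = a T / 2\<close> and is bounded by a constant \<open>M\<close>
  for which \<open>M\<^sup>2\<close> is a multiple of \<open>A = \<integral> exp(a |y|) |u\<^sub>0(y)|\<^sup>2 dy\<close>. Three facts are then combined.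

  First, the mass of \<open>u\<close> is conserved and its second moment at time \<open>T\<close> is bounded by \<open>A\<close> and the
  Sobolev norm, so the part of the mass outside the ball of radius \<open>R\<close> is of order \<open>1/R\<^sup>2\<close>
  (\<open>schroedinger_tail\<close>). Second, smallness propagates: if the transform is at most
  \<open>(\<eta>/8)^(4^J) M\<close> on a ball of radius \<open>h \<le> \<rho>/16\<close>, then it is at most \<open>\<eta> M\<close> on the concentric ball of
  radius \<open>(J+1) h\<close> (\<open>analytic_type_propagation\<close>). Third, if it exceeds \<open>\<mu> M\<close> at one point of the small
  ball, its Lipschitz bound makes the mass seen in \<open>B\<^sub>r(x\<^sub>0)\<close> at least a constant times \<open>\<mu> ^ (n + 2) * M\<^sup>2\<close>
  (\<open>analytic_type_concentration\<close>).

  With \<open>\<mu> = (\<eta>/8)^(4^J)\<close> this is a dichotomy (\<open>schroedinger_dichotomy\<close>): either \<open>u\<close> is small on the ball of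
  radius \<open>R\<close>, so its whole mass is small, or \<open>A\<close> itself is controlled by the observation, at the price
  \<open>(1/\<mu>) ^ (n + 2)\<close>. Reaching \<open>R = 1/\<epsilon>\<close> takes \<open>J\<close> of order \<open>1/\<epsilon>\<close>, so the price is doubly exponential in \<open>1/\<epsilon>\<close>,
  and \<open>exp (exp (1/\<epsilon>\<^sup>2))\<close> absorbs it as soon as \<open>1/\<epsilon>\<close> exceeds a multiple of
  \<open>D = (|x\<^sub>0| + r + 1) / min (a T) r\<close>. For larger \<open>\<epsilon>\<close> the claim is immediate, as the
  mass is at most \<open>A\<close>. Since \<open>A\<close> increases with \<open>a\<close>, one may first lower \<open>a\<close> until \<open>a T \<le> r\<close>.
\<close>

section \<open>Gaussian integrals in Euclidean space\<close>

lemma norm_power2_eq_sum_Basis: "(norm x)\<^sup>2 = (\<Sum>b\<in>Basis. (x \<bullet> b)\<^sup>2)"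
  for x :: "'a::euclidean_space"
  unfolding power2_norm_eq_inner by (subst euclidean_inner) (simp add: power2_eq_square)

lemma borel_measurable_cis [measurable]:
  assumes [measurable]: "f \<in> borel_measurable M"
  shows "(\<lambda>x. cis (f x)) \<in> borel_measurable M"
proof -
  have "cis \<in> borel_measurable borel"
    by (intro borel_measurable_continuous_onI continuous_intros)
  from measurable_compose[OF assms this] show ?thesis by simp
qed

lemma borel_measurable_cnj [measurable]:
  assumes [measurable]: "f \<in> borel_measurable M"
  shows "(\<lambda>x. cnj (f x)) \<in> borel_measurable M"
proof -
  have "cnj \<in> borel_measurable borel"
    by (intro borel_measurable_continuous_onI continuous_intros)
  from measurable_compose[OF assms this] show ?thesis by simp
qed

lemma
  fixes f :: "'a::euclidean_space \<Rightarrow> 'b::{banach, second_countable_topology}"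
  assumes [measurable]: "f \<in> borel_measurable borel" and c: "c \<noteq> (0::real)"
  shows lborel_integral_affine:
      "(\<integral>x. f x \<partial>lborel) = \<bar>c\<bar> ^ DIM('a) *\<^sub>R (\<integral>x. f (t + c *\<^sub>R x) \<partial>lborel)"
    and lborel_integrable_affine_iff:
      "integrable lborel (\<lambda>x. f (t + c *\<^sub>R x)) \<longleftrightarrow> integrable lborel f"
proof -
  have *: "(lborel :: 'a measure)
      = density (distr lborel borel (\<lambda>x. t + c *\<^sub>R x)) (\<lambda>_. ennreal (\<bar>c\<bar> ^ DIM('a)))"
    using lborel_affine[OF c, of t] by (simp add: ennreal_power)
  show "(\<integral>x. f x \<partial>lborel) = \<bar>c\<bar> ^ DIM('a) *\<^sub>R (\<integral>x. f (t + c *\<^sub>R x) \<partial>lborel)"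
    by (subst *) (simp add: integral_density integral_distr)
  show "integrable lborel (\<lambda>x. f (t + c *\<^sub>R x)) \<longleftrightarrow> integrable lborel f"
    using c integrable_scaleR_right[of "inverse (\<bar>c\<bar> ^ DIM('a))" lborel "\<lambda>x. \<bar>c\<bar> ^ DIM('a) *\<^sub>R f (t + c *\<^sub>R x)"]
    by (subst (2) *) (auto simp: integrable_density integrable_distr_eq)
qed

lemma
  fixes f :: "'a::euclidean_space \<Rightarrow> real \<Rightarrow> 'b::{real_normed_field, banach, second_countable_topology}"
  assumes int: "\<And>b. b \<in> Basis \<Longrightarrow> integrable lborel (f b)"
  shows integrable_lborel_prod: "integrable lborel (\<lambda>x::'a. \<Prod>b\<in>Basis. f b (x \<bullet> b))"
    and integral_lborel_prod:
      "(\<integral>x. (\<Prod>b\<in>Basis. f b (x \<bullet> b)) \<partial>(lborel :: 'a measure)) = (\<Prod>b\<in>Basis. (\<integral>t. f b t \<partial>lborel))"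
proof -
  interpret product_sigma_finite "\<lambda>_::'a. lborel :: real measure" by standard
  have [measurable]: "f b \<in> borel_measurable borel" if "b \<in> Basis" for b
    using borel_measurable_integrable[OF int[OF that]] by simp
  have sel: "(\<Prod>b\<in>Basis. f b ((\<Sum>i\<in>Basis. x i *\<^sub>R i) \<bullet> b)) = (\<Prod>b\<in>Basis. f b (x b))" for x :: "'a \<Rightarrow> real"
    by (intro prod.cong refl) simp
  show "integrable lborel (\<lambda>x::'a. \<Prod>b\<in>Basis. f b (x \<bullet> b))"
    by (subst lborel_eq, subst integrable_distr_eq) (auto simp: sel intro!: product_integrable_prod int)
  show "(\<integral>x. (\<Prod>b\<in>Basis. f b (x \<bullet> b)) \<partial>(lborel :: 'a measure)) = (\<Prod>b\<in>Basis. (\<integral>t. f b t \<partial>lborel))"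
    by (subst lborel_eq, subst integral_distr) (auto simp: sel intro!: product_integral_prod int)
qed

text \<open>
  The characteristic function of the standard normal distribution, rescaled by \<open>sqrt (2 \<delta>)\<close>.
\<close>
lemma
  fixes \<delta> w :: real
  assumes d: "\<delta> > 0"
  shows integrable_gaussian_cis_real:
      "integrable lborel (\<lambda>x. complex_of_real (exp (- \<delta> * x\<^sup>2)) * cis (w * x))"
    and integral_gaussian_cis_real:
      "(\<integral>x. complex_of_real (exp (- \<delta> * x\<^sup>2)) * cis (w * x) \<partial>lborel)
         = complex_of_real (sqrt (pi / \<delta>) * exp (- w\<^sup>2 / (4 * \<delta>)))"
proof -
  define c where "c = sqrt (2 * \<delta>)"
  have c: "c > 0" "c\<^sup>2 = 2 * \<delta>" using d by (auto simp: c_def)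
  define F where "F = (\<lambda>x. std_normal_density x *\<^sub>R cis (w / c * x))"
  have [measurable]: "F \<in> borel_measurable borel" unfolding F_def by measurable
  have F: "F (0 + c *\<^sub>R x) = complex_of_real (1 / sqrt (2 * pi)) * (complex_of_real (exp (- \<delta> * x\<^sup>2)) * cis (w * x))" for x
    using c by (simp add: F_def normal_density_def power_mult_distrib scaleR_conv_of_real)
  have "integrable lborel F" unfolding F_def
    by (rule Bochner_Integration.integrable_bound[where f=std_normal_density])
       (auto simp: integrable_normal_density)
  then have "integrable lborel (\<lambda>x. F (0 + c *\<^sub>R x))"
    using c by (subst lborel_integrable_affine_iff) auto
  then show "integrable lborel (\<lambda>x. complex_of_real (exp (- \<delta> * x\<^sup>2)) * cis (w * x))"
    unfolding F using integrable_mult_right[where c = "complex_of_real (sqrt (2 * pi))"] by fastforce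
  have "(\<integral>x. F x \<partial>lborel) = char std_normal_distribution (w / c)"
    unfolding char_def F_def by (subst integral_density) (auto simp: cis_conv_exp)
  also have "\<dots> = complex_of_real (exp (- w\<^sup>2 / (4 * \<delta>)))"
    unfolding char_std_normal_distribution using c by (simp add: power_divide)
  finally have 1: "complex_of_real (exp (- w\<^sup>2 / (4 * \<delta>))) = (\<integral>x. F x \<partial>lborel)" ..
  also have "\<dots> = c *\<^sub>R (\<integral>x. F (0 + c *\<^sub>R x) \<partial>lborel)"
    using c lborel_integral_affine[of F c 0] by simp
  also have "\<dots> = complex_of_real (c / sqrt (2 * pi)) * (\<integral>x. complex_of_real (exp (- \<delta> * x\<^sup>2)) * cis (w * x) \<partial>lborel)"
    unfolding F by (simp add: scaleR_conv_of_real)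
  also have "c / sqrt (2 * pi) = sqrt (\<delta> / pi)"
    unfolding c_def by (simp add: real_sqrt_divide[symmetric])
  finally have "complex_of_real (sqrt (pi / \<delta>) * exp (- w\<^sup>2 / (4 * \<delta>)))
     = complex_of_real (sqrt (pi / \<delta>) * sqrt (\<delta> / pi)) * (\<integral>x. complex_of_real (exp (- \<delta> * x\<^sup>2)) * cis (w * x) \<partial>lborel)"
    by (simp add: mult.assoc)
  also have "sqrt (pi / \<delta>) * sqrt (\<delta> / pi) = 1"
    using d by (simp add: real_sqrt_mult[symmetric])
  finally show "(\<integral>x. complex_of_real (exp (- \<delta> * x\<^sup>2)) * cis (w * x) \<partial>lborel)
         = complex_of_real (sqrt (pi / \<delta>) * exp (- w\<^sup>2 / (4 * \<delta>)))" by simp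
qed

lemma cis_sum: "finite A \<Longrightarrow> cis (\<Sum>i\<in>A. f i) = (\<Prod>i\<in>A. cis (f i))"
  by (induction A rule: finite_induct) (auto simp: cis_mult[symmetric])

lemma
  fixes w :: "'a::euclidean_space"
  assumes d: "\<delta> > 0"
  shows integrable_gaussian_cis:
      "integrable lborel (\<lambda>x. complex_of_real (exp (- \<delta> * (norm x)\<^sup>2)) * cis (w \<bullet> x))"
    and integral_gaussian_cis:
      "(\<integral>x. complex_of_real (exp (- \<delta> * (norm x)\<^sup>2)) * cis (w \<bullet> x) \<partial>lborel)
         = complex_of_real (sqrt (pi / \<delta>) ^ DIM('a) * exp (- (norm w)\<^sup>2 / (4 * \<delta>)))"
proof -
  note nrm = norm_power2_eq_sum_Basis[where 'a='a]
  have inn: "w \<bullet> x = (\<Sum>b\<in>Basis. (w \<bullet> b) * (x \<bullet> b))" for x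
    by (rule euclidean_inner)
  have prod: "complex_of_real (exp (- \<delta> * (norm x)\<^sup>2)) * cis (w \<bullet> x)
      = (\<Prod>b\<in>Basis. complex_of_real (exp (- \<delta> * (x \<bullet> b)\<^sup>2)) * cis ((w \<bullet> b) * (x \<bullet> b)))" for x
    by (subst inn, unfold nrm sum_distrib_left)
        (simp only: exp_sum[OF finite_Basis] cis_sum[OF finite_Basis] of_real_prod prod.distrib)
  show "integrable lborel (\<lambda>x. complex_of_real (exp (- \<delta> * (norm x)\<^sup>2)) * cis (w \<bullet> x))"
    unfolding prod by (intro integrable_lborel_prod integrable_gaussian_cis_real d)
  have "(\<integral>x. complex_of_real (exp (- \<delta> * (norm x)\<^sup>2)) * cis (w \<bullet> x) \<partial>lborel)
     = (\<Prod>b\<in>Basis. complex_of_real (sqrt (pi / \<delta>) * exp (- (w \<bullet> b)\<^sup>2 / (4 * \<delta>))))"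
    unfolding prod by (subst integral_lborel_prod)
      (auto simp only: integral_gaussian_cis_real[OF d] intro!: integrable_gaussian_cis_real d)
  also have "\<dots> = complex_of_real (sqrt (pi / \<delta>) ^ DIM('a) * exp (- (norm w)\<^sup>2 / (4 * \<delta>)))"
    unfolding nrm sum_negf[symmetric] sum_divide_distrib
    by (simp only: prod.distrib of_real_prod exp_sum[OF finite_Basis] of_real_mult prod_constant of_real_power)
  finally show "(\<integral>x. complex_of_real (exp (- \<delta> * (norm x)\<^sup>2)) * cis (w \<bullet> x) \<partial>lborel)
         = complex_of_real (sqrt (pi / \<delta>) ^ DIM('a) * exp (- (norm w)\<^sup>2 / (4 * \<delta>)))" .
qed

lemma
  assumes d: "\<delta> > 0"
  shows integrable_gaussian: "integrable lborel (\<lambda>x::'a::euclidean_space. exp (- \<delta> * (norm x)\<^sup>2))"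
    and integral_gaussian:
      "(\<integral>x. exp (- \<delta> * (norm x)\<^sup>2) \<partial>(lborel :: 'a measure)) = sqrt (pi / \<delta>) ^ DIM('a)"
proof -
  have "integrable lborel (\<lambda>x::'a. complex_of_real (exp (- \<delta> * (norm x)\<^sup>2)))"
    using integrable_gaussian_cis[OF d, of "0::'a"] by simp
  then show "integrable lborel (\<lambda>x::'a. exp (- \<delta> * (norm x)\<^sup>2))"
    by (simp only: complex_of_real_integrable_eq)
  have "complex_of_real (\<integral>x. exp (- \<delta> * (norm x)\<^sup>2) \<partial>(lborel :: 'a measure)) = complex_of_real (sqrt (pi / \<delta>) ^ DIM('a))"
    using integral_gaussian_cis[OF d, of "0::'a"] by simp
  then show "(\<integral>x. exp (- \<delta> * (norm x)\<^sup>2) \<partial>(lborel :: 'a measure)) = sqrt (pi / \<delta>) ^ DIM('a)"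
    by (simp only: of_real_eq_iff)
qed

section \<open>Fourier integrals and the Plancherel identity\<close>

text \<open>
  The space \<open>C\<^sub>c\<close>. The Plancherel identity is proved on this space because the
  chirped datum and its gradient are most easily seen to be continuous with compact support.
\<close>
definition compactly_supported :: "('a::euclidean_space \<Rightarrow> complex) set" where
  "compactly_supported = {f. continuous_on UNIV f \<and> (\<exists>R. \<forall>x. R < norm x \<longrightarrow> f x = 0)}"

text \<open>
  Without normalising factor, so that constants enter only where mass is compared.
\<close>
definition fourier_integral :: "('a::euclidean_space \<Rightarrow> complex) \<Rightarrow> 'a \<Rightarrow> complex" where
  "fourier_integral f \<xi> = (\<integral>x. cis (- (x \<bullet> \<xi>)) * f x \<partial>lborel)"

lemma compactly_supported_continuous:
  "f \<in> compactly_supported \<Longrightarrow> continuous_on UNIV f"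
  by (simp add: compactly_supported_def)

lemma compactly_supported_measurable:
  "f \<in> compactly_supported \<Longrightarrow> f \<in> borel_measurable borel"
  by (intro borel_measurable_continuous_onI compactly_supported_continuous)

lemma compactly_supported_mult:
  "f \<in> compactly_supported \<Longrightarrow> continuous_on UNIV g \<Longrightarrow> (\<lambda>x. g x * f x) \<in> compactly_supported"
  unfolding compactly_supported_def by (fastforce intro!: continuous_intros)

lemma compactly_supported_integrable:
  assumes "f \<in> compactly_supported" shows "integrable lborel f"
proof -
  from assms obtain R where R: "\<And>x. R < norm x \<Longrightarrow> f x = 0" and c: "continuous_on UNIV f"
    unfolding compactly_supported_def by auto
  have "integrable lborel (\<lambda>x. indicator (cball 0 R) x *\<^sub>R f x)"
    by (intro borel_integrable_compact continuous_on_subset[OF c]) auto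
  also have "(\<lambda>x. indicator (cball 0 R) x *\<^sub>R f x) = f"
    using R by (auto simp: fun_eq_iff indicator_def not_le)
  finally show ?thesis .
qed

lemma compactly_supported_bounded:
  assumes "f \<in> compactly_supported"
  obtains B where "B > 0" "\<And>x. cmod (f x) \<le> B"
proof -
  from assms obtain R where R: "\<And>x. R < norm x \<Longrightarrow> f x = 0" and c: "continuous_on UNIV f"
    unfolding compactly_supported_def by auto
  have "compact (f ` cball 0 R)"
    by (intro compact_continuous_image continuous_on_subset[OF c]) auto
  then obtain B where B: "B > 0" "\<And>x. x \<in> cball 0 R \<Longrightarrow> cmod (f x) \<le> B"
    using compact_imp_bounded bounded_pos by (metis imageI)
  have "cmod (f x) \<le> B" for x
    using B R[of x] by (cases "norm x \<le> R") auto
  with B(1) show ?thesis by (rule that)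
qed

lemma cmod_fourier_integral_le: "cmod (fourier_integral f \<xi>) \<le> (\<integral>x. cmod (f x) \<partial>lborel)"
  unfolding fourier_integral_def
  using integral_norm_bound[of lborel "\<lambda>x. cis (- (x \<bullet> \<xi>)) * f x"] by (simp add: norm_mult)

lemma fourier_integral_measurable [measurable]:
  assumes [measurable]: "f \<in> borel_measurable borel"
  shows "fourier_integral f \<in> borel_measurable borel"
  unfolding fourier_integral_def by measurable

lemma integrable_cis_mult:
  assumes "integrable M f" and [measurable]: "g \<in> borel_measurable M"
  shows "integrable M (\<lambda>x. cis (g x) * f x)"
  using assms(1) borel_measurable_integrable[OF assms(1)]
  by (intro Bochner_Integration.integrable_bound[OF assms(1)]) (auto simp: norm_mult)

text \<open>
  Fubini: the transform can be moved from one factor of an integral to the other. Applied to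
  Gaussian factors it turns integrals of transforms into convolutions.
\<close>
lemma fourier_integral_exchange:
  fixes f k :: "'a::euclidean_space \<Rightarrow> complex"
  assumes f: "integrable lborel f" and k: "integrable lborel k"
  shows "(\<integral>\<xi>. k \<xi> * fourier_integral f \<xi> \<partial>lborel) = (\<integral>x. f x * fourier_integral k x \<partial>lborel)"
proof -
  note [measurable] = borel_measurable_integrable[OF f] borel_measurable_integrable[OF k]
  define H where "H = (\<lambda>\<xi> x. cis (- (x \<bullet> \<xi>)) * f x * k \<xi>)"
  have int: "integrable (lborel \<Otimes>\<^sub>M lborel) (\<lambda>(\<xi>, x). H \<xi> x)"
  proof (rule lborel_pair.Fubini_integrable)
    show "(\<lambda>(\<xi>, x). H \<xi> x) \<in> borel_measurable (lborel \<Otimes>\<^sub>M lborel)" unfolding H_def by measurable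
    have "(\<lambda>\<xi>. \<integral>x. norm (case (\<xi>, x) of (\<xi>, x) \<Rightarrow> H \<xi> x) \<partial>lborel) = (\<lambda>\<xi>. (\<integral>x. norm (f x) \<partial>lborel) * norm (k \<xi>))"
      by (simp add: H_def norm_mult)
    then show "integrable lborel (\<lambda>\<xi>. \<integral>x. norm (case (\<xi>, x) of (\<xi>, x) \<Rightarrow> H \<xi> x) \<partial>lborel)"
      using k by simp
    show "AE \<xi> in lborel. integrable lborel (\<lambda>x. case (\<xi>, x) of (\<xi>, x) \<Rightarrow> H \<xi> x)"
      unfolding H_def case_prod_conv by (intro AE_I2 integrable_mult_left integrable_cis_mult f) measurable
  qed
  have "(\<integral>\<xi>. k \<xi> * fourier_integral f \<xi> \<partial>lborel) = (\<integral>\<xi>. (\<integral>x. H \<xi> x \<partial>lborel) \<partial>lborel)"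
    unfolding fourier_integral_def H_def by (simp add: mult.commute)
  also have "\<dots> = (\<integral>x. (\<integral>\<xi>. H \<xi> x \<partial>lborel) \<partial>lborel)"
    using lborel_pair.Fubini_integral[OF int] by simp
  also have "\<dots> = (\<integral>x. f x * fourier_integral k x \<partial>lborel)"
    unfolding fourier_integral_def H_def
    by (intro Bochner_Integration.integral_cong refl)
       (simp add: inner_commute mult.assoc mult.left_commute flip: integral_mult_right_zero)
  finally show ?thesis .
qed

text \<open>
  Inverting the transform with Gaussian damping gives the convolution with the heat kernel at time \<open>\<delta>\<close>.
\<close>
lemma integral_gaussian_fourier_integral:
  fixes f :: "'a::euclidean_space \<Rightarrow> complex"
  assumes f: "integrable lborel f" and d: "\<delta> > 0"
  shows "(\<integral>\<xi>. complex_of_real (exp (- \<delta> * (norm \<xi>)\<^sup>2)) * cis (x \<bullet> \<xi>) * fourier_integral f \<xi> \<partial>lborel)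
     = complex_of_real (sqrt (pi / \<delta>) ^ DIM('a)) *
         (\<integral>y. complex_of_real (exp (- (norm (x - y))\<^sup>2 / (4 * \<delta>))) * f y \<partial>lborel)"
proof -
  let ?k = "\<lambda>\<xi>::'a. complex_of_real (exp (- \<delta> * (norm \<xi>)\<^sup>2)) * cis (x \<bullet> \<xi>)"
  have "fourier_integral ?k y = complex_of_real (sqrt (pi / \<delta>) ^ DIM('a) * exp (- (norm (x - y))\<^sup>2 / (4 * \<delta>)))" for y
  proof -
    have "cis (- (\<xi> \<bullet> y)) * ?k \<xi> = complex_of_real (exp (- \<delta> * (norm \<xi>)\<^sup>2)) * cis ((x - y) \<bullet> \<xi>)" for \<xi>
      by (simp add: mult.left_commute cis_mult inner_diff_left inner_commute[of \<xi>])
    then show ?thesis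
      unfolding fourier_integral_def by (simp only: integral_gaussian_cis[OF d])
  qed
  then show ?thesis
    unfolding fourier_integral_exchange[OF f integrable_gaussian_cis[OF d, of x]]
    by (simp add: mult_ac flip: integral_mult_right_zero)
qed

text \<open>
  The heat kernel is an approximate identity. The substitution \<open>y = x + 2 sqrt \<delta> w\<close> has made the
  Gaussian independent of \<open>\<delta>\<close>, so dominated convergence applies.
\<close>
lemma gaussian_mean_tendsto:
  fixes f :: "'a::euclidean_space \<Rightarrow> complex"
  assumes f: "f \<in> compactly_supported" and d: "\<And>k. \<delta> k > (0::real)" "\<delta> \<longlonglongrightarrow> 0"
  shows "(\<lambda>k. \<integral>w. complex_of_real (exp (- (norm w)\<^sup>2)) * f (x + (2 * sqrt (\<delta> k)) *\<^sub>R w) \<partial>lborel)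
      \<longlonglongrightarrow> complex_of_real (sqrt pi ^ DIM('a)) * f x"
proof -
  note [measurable] = compactly_supported_measurable[OF f]
  obtain B where B: "\<And>x. cmod (f x) \<le> B" using compactly_supported_bounded[OF f] by metis
  have *: "complex_of_real (sqrt pi ^ DIM('a)) * f x = (\<integral>w. complex_of_real (exp (- (norm (w::'a))\<^sup>2)) * f x \<partial>lborel)"
    using integral_gaussian[of 1, where 'a='a] by simp
  show ?thesis unfolding *
  proof (rule integral_dominated_convergence[where w="\<lambda>w. B * exp (- (norm w)\<^sup>2)"])
    show "integrable lborel (\<lambda>w::'a. B * exp (- (norm w)\<^sup>2))"
      using integrable_gaussian[of 1, where 'a='a] by simp
    show "AE w in lborel. (\<lambda>k. complex_of_real (exp (- (norm w)\<^sup>2)) * f (x + (2 * sqrt (\<delta> k)) *\<^sub>R w))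
        \<longlonglongrightarrow> complex_of_real (exp (- (norm w)\<^sup>2)) * f x"
    proof (intro AE_I2 tendsto_mult tendsto_const)
      fix w :: 'a
      have 1: "(\<lambda>k. x + (2 * sqrt (\<delta> k)) *\<^sub>R w) \<longlonglongrightarrow> x + (2 * sqrt 0) *\<^sub>R w"
        by (intro tendsto_intros d)
      have "isCont f x" using compactly_supported_continuous[OF f]
        by (simp add: continuous_on_eq_continuous_at)
      with 1 show "(\<lambda>k. f (x + (2 * sqrt (\<delta> k)) *\<^sub>R w)) \<longlonglongrightarrow> f x"
        using isCont_tendsto_compose by fastforce
    qed
    show "AE w in lborel. norm (complex_of_real (exp (- (norm w)\<^sup>2)) * f (x + (2 * sqrt (\<delta> k)) *\<^sub>R w)) \<le> B * exp (- (norm w)\<^sup>2)" for k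
      using B by (auto simp: norm_mult mult.commute intro!: AE_I2 mult_mono)
  qed auto
qed

text \<open>
  Damp the integrand by \<open>exp (- \<delta> |\<xi>|\<^sup>2)\<close>. The damped integral equals \<open>\<integral> f (x) cnj (f * G\<^sub>\<delta>) (x) dx\<close> up to a
  constant, with \<open>G\<^sub>\<delta>\<close> the heat kernel, and tends to \<open>\<integral> |f|\<^sup>2\<close> as \<open>\<delta>\<close> tends to 0; on the Fourier side the
  convergence is monotone, which yields integrability as well as the value.
\<close>
lemma
  fixes f :: "'a::euclidean_space \<Rightarrow> complex"
  assumes f: "f \<in> compactly_supported"
  shows plancherel_integrable: "integrable lborel (\<lambda>\<xi>. (cmod (fourier_integral f \<xi>))\<^sup>2)"
    and plancherel: "(\<integral>\<xi>. (cmod (fourier_integral f \<xi>))\<^sup>2 \<partial>lborel) = (2 * pi) ^ DIM('a) * (\<integral>x. (cmod (f x))\<^sup>2 \<partial>lborel)"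
proof -
  note [measurable] = compactly_supported_measurable[OF f]
  note fi = compactly_supported_integrable[OF f]
  obtain B where B: "B > 0" "\<And>x. cmod (f x) \<le> B" using compactly_supported_bounded[OF f] by metis
  define \<delta> where "\<delta> k = 1 / real (Suc k)" for k
  have d: "\<delta> k > 0" for k by (simp add: \<delta>_def)
  have d0: "\<delta> \<longlonglongrightarrow> 0" unfolding \<delta>_def using LIMSEQ_inverse_real_of_nat by (simp add: inverse_eq_divide)
  let ?N = "DIM('a)"
  let ?L = "\<integral>x. cmod (f x) \<partial>lborel"
  \<comment> \<open>\<open>K k x\<close> is, up to a constant, the heat flow of \<open>f\<close> at time \<open>\<delta> k\<close>.\<close>
  define K where "K k x = (\<integral>w. complex_of_real (exp (- (norm w)\<^sup>2)) * f (x + (2 * sqrt (\<delta> k)) *\<^sub>R w) \<partial>lborel)" for k x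
  have K_meas [measurable]: "K k \<in> borel_measurable borel" for k unfolding K_def by measurable
  have K: "(\<integral>\<xi>. complex_of_real (exp (- \<delta> k * (norm \<xi>)\<^sup>2)) * cis (x \<bullet> \<xi>) * fourier_integral f \<xi> \<partial>lborel)
      = complex_of_real ((2 * sqrt pi) ^ ?N) * K k x" for k x
  proof -
    have "(\<integral>y. complex_of_real (exp (- (norm (x - y))\<^sup>2 / (4 * \<delta> k))) * f y \<partial>lborel)
       = (2 * sqrt (\<delta> k)) ^ ?N *\<^sub>R K k x"
      using lborel_integral_affine[of "\<lambda>y. complex_of_real (exp (- (norm (x - y))\<^sup>2 / (4 * \<delta> k))) * f y" "2 * sqrt (\<delta> k)" x] d[of k]
      by (simp add: K_def power_mult_distrib)
    moreover have "sqrt (pi / \<delta> k) ^ ?N * (2 * sqrt (\<delta> k)) ^ ?N = (2 * sqrt pi) ^ ?N"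
    proof -
      have "sqrt (pi / \<delta> k) * (2 * sqrt (\<delta> k)) = 2 * sqrt pi"
        using d[of k] by (simp add: real_sqrt_divide)
      then show ?thesis unfolding power_mult_distrib[symmetric] by (simp only:)
    qed
    ultimately show ?thesis
      unfolding integral_gaussian_fourier_integral[OF fi d]
      by (simp only: scaleR_conv_of_real mult.assoc[symmetric] of_real_mult[symmetric])
  qed
  have K_le: "cmod (K k x) \<le> B * sqrt pi ^ ?N" for k x
  proof -
    have "cmod (K k x) \<le> (\<integral>w. B * exp (- (norm (w::'a))\<^sup>2) \<partial>lborel)"
      unfolding K_def using integrable_gaussian[of 1, where 'a='a] B
      by (intro Bochner_Integration.integral_norm_bound_integral Bochner_Integration.integrable_bound[where g="\<lambda>w. complex_of_real (exp (- (norm (w::'a))\<^sup>2)) * f (x + (2 * sqrt (\<delta> k)) *\<^sub>R w)" and f="\<lambda>w. B * exp (- (norm (w::'a))\<^sup>2)"])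
         (auto simp: norm_mult mult.commute intro!: mult_mono)
    then show ?thesis using integral_gaussian[of 1, where 'a='a] by simp
  qed
  define I where "I k = (\<integral>\<xi>. exp (- \<delta> k * (norm \<xi>)\<^sup>2) * (cmod (fourier_integral f \<xi>))\<^sup>2 \<partial>lborel)" for k
  have I: "complex_of_real (I k) = complex_of_real ((2 * sqrt pi) ^ ?N) * (\<integral>x. f x * cnj (K k x) \<partial>lborel)" for k
  proof -
    let ?E = "\<lambda>\<xi>::'a. complex_of_real (exp (- \<delta> k * (norm \<xi>)\<^sup>2))"
    let ?k = "\<lambda>\<xi>. ?E \<xi> * cnj (fourier_integral f \<xi>)"
    have [measurable]: "?k \<in> borel_measurable borel"
      by measurable
    have k: "integrable lborel ?k"
    proof (rule Bochner_Integration.integrable_bound)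
      show "integrable lborel (\<lambda>\<xi>::'a. exp (- \<delta> k * (norm \<xi>)\<^sup>2) * ?L)"
        using integrable_gaussian[OF d, of k, where 'a='a] by simp
    qed (auto simp: norm_mult cmod_fourier_integral_le abs_mult intro!: mult_left_mono order_trans[OF cmod_fourier_integral_le])
    have "complex_of_real (I k) = (\<integral>\<xi>. ?k \<xi> * fourier_integral f \<xi> \<partial>lborel)"
      unfolding I_def integral_complex_of_real[symmetric]
      by (intro Bochner_Integration.integral_cong refl)
         (simp add: complex_norm_square mult_ac del: of_real_power)
    also have "\<dots> = (\<integral>x. f x * fourier_integral ?k x \<partial>lborel)"
      by (rule fourier_integral_exchange[OF fi k])
    also have "fourier_integral ?k = (\<lambda>x. complex_of_real ((2 * sqrt pi) ^ ?N) * cnj (K k x))"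
    proof
      fix x
      have "fourier_integral ?k x = (\<integral>\<xi>. cnj (?E \<xi> * cis (x \<bullet> \<xi>) * fourier_integral f \<xi>) \<partial>lborel)"
        unfolding fourier_integral_def[of ?k]
        by (intro Bochner_Integration.integral_cong refl) (simp add: inner_commute mult_ac cis_cnj)
      also have "\<dots> = cnj (\<integral>\<xi>. ?E \<xi> * cis (x \<bullet> \<xi>) * fourier_integral f \<xi> \<partial>lborel)"
        by (rule Bochner_Integration.integral_cnj)
      finally show "fourier_integral ?k x = complex_of_real ((2 * sqrt pi) ^ ?N) * cnj (K k x)"
        unfolding K by simp
    qed
    finally show ?thesis
      by (simp add: mult.left_commute[of "f _"] del: of_real_mult of_real_power)
  qed
  have "(\<lambda>k. \<integral>x. f x * cnj (K k x) \<partial>lborel) \<longlonglongrightarrow> (\<integral>x. f x * cnj (complex_of_real (sqrt pi ^ ?N) * f x) \<partial>lborel)"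
  proof (rule integral_dominated_convergence[where w="\<lambda>x. cmod (f x) * (B * sqrt pi ^ ?N)"])
    show "integrable lborel (\<lambda>x. cmod (f x) * (B * sqrt pi ^ ?N))" using fi by simp
    show "AE x in lborel. (\<lambda>k. f x * cnj (K k x)) \<longlonglongrightarrow> f x * cnj (complex_of_real (sqrt pi ^ ?N) * f x)"
      unfolding K_def by (intro AE_I2 tendsto_intros gaussian_mean_tendsto f d d0)
    show "AE x in lborel. norm (f x * cnj (K k x)) \<le> cmod (f x) * (B * sqrt pi ^ ?N)" for k
      using K_le by (auto simp: norm_mult intro!: AE_I2 mult_left_mono)
  qed auto
  also have "(\<integral>x. f x * cnj (complex_of_real (sqrt pi ^ ?N) * f x) \<partial>lborel)
      = complex_of_real (sqrt pi ^ ?N * (\<integral>x. (cmod (f x))\<^sup>2 \<partial>lborel))"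
    unfolding integral_complex_of_real[symmetric] of_real_mult integral_mult_right_zero[symmetric]
    by (intro Bochner_Integration.integral_cong refl) (simp add: complex_norm_square mult_ac del: of_real_power)
  finally have "(\<lambda>k. complex_of_real (I k)) \<longlonglongrightarrow> complex_of_real ((2 * sqrt pi) ^ ?N) * complex_of_real (sqrt pi ^ ?N * (\<integral>x. (cmod (f x))\<^sup>2 \<partial>lborel))"
    unfolding I by (intro tendsto_mult tendsto_const)
  also have "complex_of_real ((2 * sqrt pi) ^ ?N) * complex_of_real (sqrt pi ^ ?N * (\<integral>x. (cmod (f x))\<^sup>2 \<partial>lborel))
      = complex_of_real ((2 * pi) ^ ?N * (\<integral>x. (cmod (f x))\<^sup>2 \<partial>lborel))"
  proof -
    have "(2 * sqrt pi) ^ ?N * sqrt pi ^ ?N = (2 * pi) ^ ?N"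
    proof -
      have "2 * sqrt pi * sqrt pi = 2 * pi" by simp
      then show ?thesis unfolding power_mult_distrib[symmetric] by (simp only:)
    qed
    then show ?thesis unfolding of_real_mult[symmetric] mult.assoc[symmetric] by (simp only:)
  qed
  finally have lim: "I \<longlonglongrightarrow> (2 * pi) ^ ?N * (\<integral>x. (cmod (f x))\<^sup>2 \<partial>lborel)"
    by (simp only: tendsto_of_real_iff)
  have int: "integrable lborel (\<lambda>\<xi>. exp (- \<delta> k * (norm \<xi>)\<^sup>2) * (cmod (fourier_integral f \<xi>))\<^sup>2)" for k
  proof (rule Bochner_Integration.integrable_bound)
    show "integrable lborel (\<lambda>\<xi>::'a. exp (- \<delta> k * (norm \<xi>)\<^sup>2) * ?L\<^sup>2)"
      using integrable_gaussian[OF d, of k, where 'a='a] by simp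
  qed (auto simp: abs_mult intro!: mult_left_mono power_mono cmod_fourier_integral_le)
  have mono: "AE \<xi> in lborel. mono (\<lambda>k. exp (- \<delta> k * (norm \<xi>)\<^sup>2) * (cmod (fourier_integral f \<xi>))\<^sup>2)"
  proof (intro AE_I2 monoI mult_right_mono)
    fix \<xi> :: 'a and j k :: nat
    assume "j \<le> k"
    then have "\<delta> k \<le> \<delta> j" unfolding \<delta>_def by (intro divide_left_mono) auto
    then show "exp (- \<delta> j * (norm \<xi>)\<^sup>2) \<le> exp (- \<delta> k * (norm \<xi>)\<^sup>2)"
      by (simp add: mult_right_mono)
  qed simp
  have conv: "AE \<xi> in lborel. (\<lambda>k. exp (- \<delta> k * (norm \<xi>)\<^sup>2) * (cmod (fourier_integral f \<xi>))\<^sup>2) \<longlonglongrightarrow> (cmod (fourier_integral f \<xi>))\<^sup>2"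
  proof (intro AE_I2)
    fix \<xi>
    have "(\<lambda>k. exp (- \<delta> k * (norm \<xi>)\<^sup>2) * (cmod (fourier_integral f \<xi>))\<^sup>2) \<longlonglongrightarrow> exp (- 0 * (norm \<xi>)\<^sup>2) * (cmod (fourier_integral f \<xi>))\<^sup>2"
      by (intro tendsto_intros d0)
    then show "(\<lambda>k. exp (- \<delta> k * (norm \<xi>)\<^sup>2) * (cmod (fourier_integral f \<xi>))\<^sup>2) \<longlonglongrightarrow> (cmod (fourier_integral f \<xi>))\<^sup>2" by simp
  qed
  show "integrable lborel (\<lambda>\<xi>. (cmod (fourier_integral f \<xi>))\<^sup>2)"
    by (rule integrable_monotone_convergence[OF int mono conv lim[unfolded I_def]]) measurable
  show "(\<integral>\<xi>. (cmod (fourier_integral f \<xi>))\<^sup>2 \<partial>lborel) = (2 * pi) ^ ?N * (\<integral>x. (cmod (f x))\<^sup>2 \<partial>lborel)"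
    by (rule integral_monotone_convergence[OF int mono conv lim[unfolded I_def]]) measurable
qed

section \<open>Derivatives, decay of the transform, and test functions\<close>

definition C1_compact :: "('a::euclidean_space \<Rightarrow> complex) set" where
  "C1_compact = {f \<in> compactly_supported. C_k 1 f}"

lemma C1_compactD:
  assumes "f \<in> C1_compact"
  shows "f \<in> compactly_supported" "f differentiable (at x)"
    "continuous_on UNIV (\<lambda>x. frechet_derivative f (at x) v)"
  using assms by (auto simp: C1_compact_def)

lemma C1_compactI:
  assumes "f \<in> compactly_supported" "\<And>x. f differentiable (at x)"
    "\<And>v. continuous_on UNIV (\<lambda>x. frechet_derivative f (at x) v)"
  shows "f \<in> C1_compact"
  using assms by (auto simp: C1_compact_def)

lemma frechet_derivative_eq_0_outside:
  fixes f :: "'a::euclidean_space \<Rightarrow> complex"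
  assumes "open S" "x \<in> S" "\<And>y. y \<in> S \<Longrightarrow> f y = 0"
  shows "frechet_derivative f (at x) v = 0"
proof -
  have "(f has_derivative (\<lambda>_. 0)) (at x)"
    by (rule has_derivative_transform_within_open[where f="\<lambda>_. 0", OF _ assms(1,2)]) (use assms(3) in auto)
  then show ?thesis using frechet_derivative_at by metis
qed

lemma compactly_supported_frechet_derivative:
  fixes f :: "'a::euclidean_space \<Rightarrow> complex"
  assumes f: "f \<in> C1_compact"
  shows "(\<lambda>x. frechet_derivative f (at x) v) \<in> compactly_supported"
proof -
  from f obtain R where R: "\<And>x. R < norm x \<Longrightarrow> f x = 0"
    unfolding C1_compact_def compactly_supported_def by auto
  have "frechet_derivative f (at x) v = 0" if "R < norm x" for x
  proof (rule frechet_derivative_eq_0_outside[where S="- cball 0 R"])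
    show "open (- cball (0::'a) R)" by (simp add: open_Compl)
  qed (use that R in auto)
  with C1_compactD(3)[OF f] show ?thesis unfolding compactly_supported_def by auto
qed

text \<open>
  Translation invariance: the integral of every difference quotient of \<open>f\<close> vanishes, and the
  quotients converge dominatedly, by the mean value inequality on a segment of direction \<open>v\<close>.
\<close>
lemma integral_frechet_derivative_eq_0:
  fixes f :: "'a::euclidean_space \<Rightarrow> complex"
  assumes f: "f \<in> C1_compact"
  shows "(\<integral>x. frechet_derivative f (at x) v \<partial>lborel) = 0"
proof -
  let ?D = "\<lambda>x. frechet_derivative f (at x) v"
  have fc: "f \<in> compactly_supported" using f by (rule C1_compactD)
  note [measurable] = compactly_supported_measurable[OF fc]
    compactly_supported_measurable[OF compactly_supported_frechet_derivative[OF f, of v]]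
  obtain R where R: "\<And>x. R < norm x \<Longrightarrow> f x = 0" using fc unfolding compactly_supported_def by auto
  obtain B where B: "B > 0" "\<And>x. cmod (?D x) \<le> B"
    using compactly_supported_bounded[OF compactly_supported_frechet_derivative[OF f, of v]] by metis
  have der: "(f has_derivative frechet_derivative f (at x)) (at x)" for x
    using C1_compactD(2)[OF f] frechet_derivative_works by blast
  have der_line: "((\<lambda>s. f (x + s *\<^sub>R v)) has_derivative (\<lambda>h. h *\<^sub>R ?D (x + s *\<^sub>R v))) (at s)" for x and s :: real
  proof -
    have "((\<lambda>s. x + s *\<^sub>R v) has_derivative (\<lambda>h. h *\<^sub>R v)) (at s)"
      by (auto intro!: derivative_eq_intros)
    from has_derivative_compose[OF this der] show ?thesis
      by (simp add: linear_scale[OF bounded_linear.linear[OF has_derivative_bounded_linear[OF der]]])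
  qed
  define t where "t k = 1 / real (Suc k)" for k
  have t: "0 < t k" "t k \<le> 1" for k by (auto simp: t_def)
  have t0: "t \<longlonglongrightarrow> 0" unfolding t_def using LIMSEQ_inverse_real_of_nat by (simp add: inverse_eq_divide)
  define Q where "Q k x = (1 / t k) *\<^sub>R (f (x + t k *\<^sub>R v) - f x)" for k x
  have Q0: "(\<integral>x. Q k x \<partial>lborel) = 0" for k
  proof -
    have i: "integrable lborel f" by (rule compactly_supported_integrable[OF fc])
    have "integrable lborel (\<lambda>x. f (t k *\<^sub>R v + 1 *\<^sub>R x))"
      using i by (subst lborel_integrable_affine_iff) auto
    moreover have "(\<integral>x. f x \<partial>lborel) = (\<integral>x. f (t k *\<^sub>R v + 1 *\<^sub>R x) \<partial>lborel)"
      using lborel_integral_affine[of f 1 "t k *\<^sub>R v"] by simp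
    ultimately show ?thesis using i
      unfolding Q_def by (simp add: add.commute[of _ "t k *\<^sub>R v"])
  qed
  have "(\<lambda>k. \<integral>x. Q k x \<partial>lborel) \<longlonglongrightarrow> (\<integral>x. ?D x \<partial>lborel)"
  proof (rule integral_dominated_convergence[where w="\<lambda>x. indicator (cball 0 (R + norm v)) x *\<^sub>R B"])
    show "integrable lborel (\<lambda>x. indicator (cball 0 (R + norm v)) x *\<^sub>R B)"
      by (intro borel_integrable_compact) auto
    show "Q k \<in> borel_measurable lborel" for k unfolding Q_def by measurable
    \<comment> \<open>As \<open>t k \<le> 1\<close>, the quotients are supported in the ball enlarged by \<open>norm v\<close>.\<close>
    show "AE x in lborel. norm (Q k x) \<le> indicator (cball 0 (R + norm v)) x *\<^sub>R B" for k
    proof (intro AE_I2)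
      fix x
      show "norm (Q k x) \<le> indicator (cball 0 (R + norm v)) x *\<^sub>R B"
      proof (cases "norm x \<le> R + norm v")
        case True
        have "continuous_on {0..t k} (\<lambda>s. f (x + s *\<^sub>R v))"
          using has_derivative_continuous[OF der_line] by (intro continuous_at_imp_continuous_on) blast
        from mvt_general[where a=0 and b="t k" and f="\<lambda>s. f (x + s *\<^sub>R v)"
            and f'="\<lambda>s h. h *\<^sub>R ?D (x + s *\<^sub>R v)", OF t(1) this der_line]
        obtain s where "norm (f (x + t k *\<^sub>R v) - f x) \<le> norm ((t k - 0) *\<^sub>R ?D (x + s *\<^sub>R v))"
          by auto
        also have "\<dots> \<le> t k * B" using t[of k] B by (auto intro!: mult_left_mono)
        finally have "norm (f (x + t k *\<^sub>R v) - f x) / t k \<le> B"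
          using t[of k] by (simp add: field_simps)
        moreover have "norm (Q k x) = norm (f (x + t k *\<^sub>R v) - f x) / t k"
          unfolding Q_def norm_scaleR using t[of k] by simp
        ultimately show ?thesis using True by simp
      next
        case False
        have "norm (x + t k *\<^sub>R v) \<ge> norm x - norm (t k *\<^sub>R v)"
          using norm_triangle_ineq4[of "x + t k *\<^sub>R v" "t k *\<^sub>R v"] by simp
        moreover have "norm (t k *\<^sub>R v) \<le> norm v" using t[of k] by (simp add: mult_left_le_one_le)
        ultimately have "R < norm (x + t k *\<^sub>R v)" using False by linarith
        moreover have "R < norm x" using False norm_ge_zero[of v] by linarith
        ultimately show ?thesis using False R by (simp add: Q_def)
      qed
    qed
    show "AE x in lborel. (\<lambda>k. Q k x) \<longlonglongrightarrow> ?D x"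
    proof (intro AE_I2)
      fix x
      have eq: "norm (f (x + s *\<^sub>R v) - f x - s *\<^sub>R ?D x) / norm s
          = norm ((f (x + s *\<^sub>R v) - f x) /\<^sub>R s - ?D x)" if "s \<noteq> 0" for s
      proof -
        have "(f (x + s *\<^sub>R v) - f x) /\<^sub>R s - ?D x = (f (x + s *\<^sub>R v) - f x - s *\<^sub>R ?D x) /\<^sub>R s"
          using that by (simp add: scaleR_diff_right)
        then show ?thesis by (simp only: norm_scaleR) (simp add: field_simps)
      qed
      have "((\<lambda>s. norm (f (x + s *\<^sub>R v) - f x - s *\<^sub>R ?D x) / norm s) \<longlongrightarrow> 0) (at 0)"
        using der_line[of x 0] unfolding has_derivative_at by simp
      then have "((\<lambda>s. norm ((f (x + s *\<^sub>R v) - f x) /\<^sub>R s - ?D x)) \<longlongrightarrow> 0) (at 0)"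
        by (rule Lim_transform_eventually) (use eq in \<open>simp add: eventually_at_filter\<close>)
      then have "((\<lambda>s. (f (x + s *\<^sub>R v) - f x) /\<^sub>R s) \<longlongrightarrow> ?D x) (at 0)"
        by (rule LIM_zero_cancel[OF tendsto_norm_zero_cancel])
      moreover have "filterlim t (at 0) sequentially"
        using t0 by (simp add: filterlim_at t_def)
      ultimately have "(\<lambda>k. (f (x + t k *\<^sub>R v) - f x) /\<^sub>R t k) \<longlonglongrightarrow> ?D x"
        by (rule filterlim_compose)
      then show "(\<lambda>k. Q k x) \<longlonglongrightarrow> ?D x" by (simp add: Q_def inverse_eq_divide)
    qed
    show "?D \<in> borel_measurable lborel" by measurable
  qed
  then show ?thesis unfolding Q0 by (simp add: LIMSEQ_const_iff)
qed

lemma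
  fixes f :: "'a::euclidean_space \<Rightarrow> complex"
  assumes p: "(p has_derivative p') (at x)" and f: "f differentiable (at x)"
  shows cis_mult_differentiable: "(\<lambda>y. cis (p y) * f y) differentiable (at x)"
    and frechet_derivative_cis_mult: "frechet_derivative (\<lambda>y. cis (p y) * f y) (at x) v
      = cis (p x) * (frechet_derivative f (at x) v + \<i> * p' v * f x)"
proof -
  have "(f has_derivative frechet_derivative f (at x)) (at x)"
    using f frechet_derivative_works by blast
  from has_derivative_mult[OF has_derivative_cis[OF p] this]
  have *: "((\<lambda>y. cis (p y) * f y) has_derivative
      (\<lambda>v. cis (p x) * (frechet_derivative f (at x) v + \<i> * p' v * f x))) (at x)"
    by (rule back_subst[where P="\<lambda>d. (_ has_derivative d) (at x)"])
       (auto simp: fun_eq_iff scaleR_conv_of_real algebra_simps)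
  show "(\<lambda>y. cis (p y) * f y) differentiable (at x)"
    using * differentiableI by blast
  show "frechet_derivative (\<lambda>y. cis (p y) * f y) (at x) v
      = cis (p x) * (frechet_derivative f (at x) v + \<i> * p' v * f x)"
    by (rule fun_cong[OF frechet_derivative_at[OF *], symmetric])
qed

lemma C1_compact_cis_mult:
  fixes f :: "'a::euclidean_space \<Rightarrow> complex"
  assumes f: "f \<in> C1_compact" and p: "\<And>x. (p has_derivative p' x) (at x)"
    and p': "\<And>v. continuous_on UNIV (\<lambda>x. p' x v)"
  shows "(\<lambda>x. cis (p x) * f x) \<in> C1_compact"
proof (rule C1_compactI)
  have cp: "continuous_on UNIV p"
    using has_derivative_continuous[OF p] by (intro continuous_at_imp_continuous_on ballI)
  show "(\<lambda>x. cis (p x) * f x) \<in> compactly_supported"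
    by (rule compactly_supported_mult[OF C1_compactD(1)[OF f] continuous_on_cis[OF cp]])
  show "(\<lambda>x. cis (p x) * f x) differentiable at x" for x
    by (rule cis_mult_differentiable[OF p C1_compactD(2)[OF f]])
  show "continuous_on UNIV (\<lambda>x. frechet_derivative (\<lambda>x. cis (p x) * f x) (at x) v)" for v
    unfolding frechet_derivative_cis_mult[OF p C1_compactD(2)[OF f]]
    by (intro continuous_intros cp p' C1_compactD(3)[OF f] compactly_supported_continuous[OF C1_compactD(1)[OF f]])
qed

text \<open>
  Integration by parts: the derivative of \<open>x \<mapsto> cis (- (x \<bullet> \<xi>)) * f x\<close> integrates to zero.
\<close>
lemma fourier_integral_frechet_derivative:
  fixes f :: "'a::euclidean_space \<Rightarrow> complex"
  assumes f: "f \<in> C1_compact"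
  shows "fourier_integral (\<lambda>x. frechet_derivative f (at x) v) \<xi> = \<i> * (v \<bullet> \<xi>) * fourier_integral f \<xi>"
proof -
  have p: "((\<lambda>x. - (x \<bullet> \<xi>)) has_derivative (\<lambda>v. - (v \<bullet> \<xi>))) (at x)" for x
    by (auto intro!: derivative_eq_intros)
  have "(\<lambda>x. cis (- (x \<bullet> \<xi>)) * f x) \<in> C1_compact"
    by (rule C1_compact_cis_mult[OF f p]) (intro continuous_intros)
  from integral_frechet_derivative_eq_0[OF this, of v]
  have "0 = (\<integral>x. cis (- (x \<bullet> \<xi>)) * frechet_derivative f (at x) v - \<i> * (v \<bullet> \<xi>) * (cis (- (x \<bullet> \<xi>)) * f x) \<partial>lborel)"
    unfolding frechet_derivative_cis_mult[OF p C1_compactD(2)[OF f]] by (simp add: algebra_simps)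
  also have "\<dots> = fourier_integral (\<lambda>x. frechet_derivative f (at x) v) \<xi> - \<i> * (v \<bullet> \<xi>) * fourier_integral f \<xi>"
    unfolding fourier_integral_def
    using compactly_supported_integrable[OF compactly_supported_frechet_derivative[OF f, of v]]
      compactly_supported_integrable[OF C1_compactD(1)[OF f]]
    by (subst Bochner_Integration.integral_diff) (auto intro!: integrable_mult_right integrable_cis_mult)
  finally show ?thesis by simp
qed

lemma test_function_C1_compact:
  assumes "f \<in> test_functions" shows "f \<in> C1_compact"
proof -
  from assms have K: "compact (closure {x. f x \<noteq> 0})" and C: "C_k k f" for k
    by (auto simp: test_functions_def)
  obtain R where R: "\<And>x. x \<in> closure {x. f x \<noteq> 0} \<Longrightarrow> norm x \<le> R"
    using compact_imp_bounded[OF K] unfolding bounded_iff by auto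
  have "f x = 0" if "R < norm x" for x
    using R[of x] that closure_subset[of "{x. f x \<noteq> 0}"] by fastforce
  with C[of 0] C[of 1] show ?thesis by (auto simp: C1_compact_def compactly_supported_def)
qed

lemma test_function_frechet_derivative:
  assumes f: "f \<in> test_functions"
  shows "(\<lambda>x. frechet_derivative f (at x) v) \<in> test_functions"
proof -
  let ?S = "closure {x. f x \<noteq> 0}"
  from f have K: "compact ?S" and C: "C_k (Suc k) f" for k
    unfolding test_functions_def by blast+
  have "frechet_derivative f (at x) v = 0" if "x \<notin> ?S" for x
    by (rule frechet_derivative_eq_0_outside[where S="- ?S"])
       (use that closure_subset[of "{x. f x \<noteq> 0}"] in auto)
  then have "closure {x. frechet_derivative f (at x) v \<noteq> 0} \<subseteq> ?S"
    by (intro closure_minimal) auto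
  then have "compact (closure {x. frechet_derivative f (at x) v \<noteq> 0})"
    using compact_Int_closed[OF K closed_closure, of "{x. frechet_derivative f (at x) v \<noteq> 0}"]
    by (simp add: Int_absorb1)
  with C show ?thesis by (auto simp: test_functions_def)
qed

text \<open>
  Multiplication by \<open>1 + |\<xi>|\<^sup>2\<close> corresponds to \<open>f \<mapsto> f - \<Sum> b. D\<^sub>b D\<^sub>b f\<close>, and test functions are stable
  under derivatives, so the induction runs over all test functions at once.
\<close>
lemma test_function_fourier_decay:
  assumes "f \<in> test_functions"
  shows "\<exists>C. \<forall>\<xi>. (1 + (norm \<xi>)\<^sup>2) ^ k * cmod (fourier_integral f \<xi>) \<le> C"
  using assms
proof (induction k arbitrary: f)
  case 0
  then show ?case using cmod_fourier_integral_le[of f] by auto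
next
  case (Suc k)
  let ?D = "\<lambda>b f x. frechet_derivative f (at x) b"
  obtain C0 where C0: "\<And>\<xi>. (1 + (norm \<xi>)\<^sup>2) ^ k * cmod (fourier_integral f \<xi>) \<le> C0"
    using Suc by blast
  have DD: "?D b (?D b f) \<in> test_functions" for b
    by (intro test_function_frechet_derivative Suc.prems)
  then have "\<forall>b. \<exists>C. \<forall>\<xi>. (1 + (norm \<xi>)\<^sup>2) ^ k * cmod (fourier_integral (?D b (?D b f)) \<xi>) \<le> C"
    using Suc.IH by blast
  then obtain C where C: "\<And>b \<xi>. (1 + (norm \<xi>)\<^sup>2) ^ k * cmod (fourier_integral (?D b (?D b f)) \<xi>) \<le> C b"
    by metis
  have "(1 + (norm \<xi>)\<^sup>2) ^ Suc k * cmod (fourier_integral f \<xi>) \<le> C0 + (\<Sum>b\<in>Basis. C b)" for \<xi>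
  proof -
    have "cmod (fourier_integral (?D b (?D b f)) \<xi>) = (\<xi> \<bullet> b)\<^sup>2 * cmod (fourier_integral f \<xi>)" for b
      using fourier_integral_frechet_derivative[OF test_function_C1_compact[OF test_function_frechet_derivative[OF Suc.prems]], of b b \<xi>]
        fourier_integral_frechet_derivative[OF test_function_C1_compact[OF Suc.prems], of b \<xi>]
      by (simp add: norm_mult power2_eq_square inner_commute)
    moreover note norm_power2_eq_sum_Basis[of \<xi>]
    ultimately have "(\<Sum>b\<in>Basis. (1 + (norm \<xi>)\<^sup>2) ^ k * cmod (fourier_integral (?D b (?D b f)) \<xi>))
        = (1 + (norm \<xi>)\<^sup>2) ^ k * ((norm \<xi>)\<^sup>2 * cmod (fourier_integral f \<xi>))"
      by (simp only: sum_distrib_left sum_distrib_right)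
    then have "(1 + (norm \<xi>)\<^sup>2) ^ Suc k * cmod (fourier_integral f \<xi>)
        = (1 + (norm \<xi>)\<^sup>2) ^ k * cmod (fourier_integral f \<xi>)
          + (\<Sum>b\<in>Basis. (1 + (norm \<xi>)\<^sup>2) ^ k * cmod (fourier_integral (?D b (?D b f)) \<xi>))"
      by (simp add: algebra_simps)
    also have "\<dots> \<le> C0 + (\<Sum>b\<in>Basis. C b)" by (intro add_mono sum_mono C0 C)
    finally show ?thesis .
  qed
  then show ?case by blast
qed

text \<open>
  The product of the one-dimensional weights \<open>1 / (1 + t\<^sup>2)\<close> is integrable and dominates
  \<open>1 / (1 + |\<xi>|\<^sup>2) ^ n\<close>.
\<close>
lemma integrable_of_decay:
  fixes g :: "'a::euclidean_space \<Rightarrow> 'b::{banach, second_countable_topology}"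
  assumes [measurable]: "g \<in> borel_measurable borel"
    and C: "\<And>\<xi>. (1 + (norm \<xi>)\<^sup>2) ^ DIM('a) * norm (g \<xi>) \<le> C"
  shows "integrable lborel g"
proof (rule Bochner_Integration.integrable_bound)
  have "set_integrable lborel UNIV (\<lambda>x::real. inverse (1 + x\<^sup>2))"
    using integrable_inverse_1_plus_square by (simp add: einterval_eq)
  then have "integrable lborel (\<lambda>x::real. inverse (1 + x\<^sup>2))"
    by (simp add: set_integrable_def)
  then have "integrable lborel (\<lambda>\<xi>::'a. \<Prod>b\<in>Basis. inverse (1 + (\<xi> \<bullet> b)\<^sup>2))"
    by (intro integrable_lborel_prod[where f="\<lambda>_ x. inverse (1 + x\<^sup>2)"])
  then show "integrable lborel (\<lambda>\<xi>::'a. C * (\<Prod>b\<in>Basis. inverse (1 + (\<xi> \<bullet> b)\<^sup>2)))"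
    by simp
  show "AE \<xi> in lborel. norm (g \<xi>) \<le> norm (C * (\<Prod>b\<in>Basis. inverse (1 + (\<xi> \<bullet> b)\<^sup>2)))"
  proof (intro AE_I2)
    fix \<xi> :: 'a
    let ?P = "\<Prod>b\<in>Basis. (1 + (\<xi> \<bullet> b)\<^sup>2)"
    have "\<bar>\<xi> \<bullet> b\<bar> \<le> norm \<xi>" if "b \<in> Basis" for b using Basis_le_norm[OF that] .
    then have "?P \<le> (\<Prod>b\<in>(Basis::'a set). (1 + (norm \<xi>)\<^sup>2))"
      by (intro prod_mono) (auto simp: abs_le_square_iff[symmetric])
    then have "?P * norm (g \<xi>) \<le> C" using C[of \<xi>] by (simp add: mult_right_mono order_trans[rotated])
    moreover have "?P > 0" by (intro prod_pos) (auto intro: add_pos_nonneg)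
    ultimately have "norm (g \<xi>) \<le> C / ?P" by (simp add: field_simps)
    also have "\<dots> \<le> norm (C * (\<Prod>b\<in>Basis. inverse (1 + (\<xi> \<bullet> b)\<^sup>2)))"
      using abs_ge_self[of "C / ?P"] prod_inversef[of "\<lambda>b. 1 + (\<xi> \<bullet> b)\<^sup>2" Basis]
      by (simp add: divide_inverse comp_def)
    finally show "norm (g \<xi>) \<le> norm (C * (\<Prod>b\<in>Basis. inverse (1 + (\<xi> \<bullet> b)\<^sup>2)))" .
  qed
qed simp

lemma test_function_fourier_integrable:
  assumes f: "f \<in> test_functions"
  shows "integrable lborel (fourier_integral f)"
    and "integrable lborel (\<lambda>\<xi>. (1 + (norm \<xi>)\<^sup>2) ^ k * (cmod (fourier_integral f \<xi>))\<^sup>2)"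
proof -
  note [measurable] = compactly_supported_measurable[OF C1_compactD(1)[OF test_function_C1_compact[OF f]]]
  let ?N = "CARD('a)"
  obtain C where C: "\<And>\<xi>. (1 + (norm \<xi>)\<^sup>2) ^ (?N + k) * cmod (fourier_integral f \<xi>) \<le> C"
    using test_function_fourier_decay[OF f] by blast
  obtain C0 where C0: "\<And>\<xi>. cmod (fourier_integral f \<xi>) \<le> C0"
    using cmod_fourier_integral_le by blast
  obtain C1 where C1: "\<And>\<xi>. (1 + (norm \<xi>)\<^sup>2) ^ ?N * cmod (fourier_integral f \<xi>) \<le> C1"
    using test_function_fourier_decay[OF f] by blast
  show "integrable lborel (fourier_integral f)"
    by (rule integrable_of_decay[where C=C1]) (use C1 in auto)
  show "integrable lborel (\<lambda>\<xi>. (1 + (norm \<xi>)\<^sup>2) ^ k * (cmod (fourier_integral f \<xi>))\<^sup>2)"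
  proof (rule integrable_of_decay[where C="C * C0"])
    fix \<xi> :: "real^'a"
    have "(1 + (norm \<xi>)\<^sup>2) ^ DIM(real^'a) * norm ((1 + (norm \<xi>)\<^sup>2) ^ k * (cmod (fourier_integral f \<xi>))\<^sup>2)
      = ((1 + (norm \<xi>)\<^sup>2) ^ (?N + k) * cmod (fourier_integral f \<xi>)) * cmod (fourier_integral f \<xi>)"
      by (simp add: power_add power2_eq_square abs_mult mult_ac)
    also have "\<dots> \<le> C * C0"
      by (intro mult_mono C C0 order_trans[OF _ C[of \<xi>]]) auto
    finally show "(1 + (norm \<xi>)\<^sup>2) ^ DIM(real^'a) * norm ((1 + (norm \<xi>)\<^sup>2) ^ k * (cmod (fourier_integral f \<xi>))\<^sup>2) \<le> C * C0" .
  qed measurable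
qed

section \<open>The Schroedinger kernel\<close>

lemma measurable_exp_complex [measurable]:
  assumes [measurable]: "f \<in> borel_measurable M"
  shows "(\<lambda>x. exp (f x :: complex)) \<in> borel_measurable M"
proof -
  have "(exp :: complex \<Rightarrow> complex) \<in> borel_measurable borel"
    by (intro borel_measurable_continuous_onI continuous_intros)
  from measurable_compose[OF assms this] show ?thesis by simp
qed

lemma cmod_exp_neg_mult: "cmod (exp (- z * complex_of_real s)) = exp (- Re z * s)"
  by (simp add: norm_exp_eq_Re)

lemma laplace_transform_continuous:
  fixes k :: "'a::euclidean_space \<Rightarrow> complex"
  assumes k: "integrable lborel k" and [measurable]: "p \<in> borel_measurable borel"
    and p: "\<And>x. p x \<ge> (0::real)"
  shows "continuous_on {z. Re z \<ge> 0} (\<lambda>z. \<integral>x. exp (- z * complex_of_real (p x)) * k x \<partial>lborel)"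
  unfolding continuous_on_sequentially comp_def
proof safe
  fix z and w :: "nat \<Rightarrow> complex"
  assume w: "\<forall>n. w n \<in> {z. Re z \<ge> 0}" and lim: "w \<longlonglongrightarrow> z"
  note [measurable] = borel_measurable_integrable[OF k]
  show "(\<lambda>n. \<integral>x. exp (- w n * complex_of_real (p x)) * k x \<partial>lborel)
      \<longlonglongrightarrow> (\<integral>x. exp (- z * complex_of_real (p x)) * k x \<partial>lborel)"
  proof (rule integral_dominated_convergence[where w="\<lambda>x. cmod (k x)"])
    show "integrable lborel (\<lambda>x. cmod (k x))" using k by simp
    show "AE x in lborel. (\<lambda>n. exp (- w n * complex_of_real (p x)) * k x) \<longlonglongrightarrow> exp (- z * complex_of_real (p x)) * k x"
      by (intro AE_I2 tendsto_intros lim)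
    show "AE x in lborel. norm (exp (- w n * complex_of_real (p x)) * k x) \<le> cmod (k x)" for n
    proof (intro AE_I2)
      fix x
      have "exp (- Re (w n) * p x) \<le> 1" using w p by simp
      then show "norm (exp (- w n * complex_of_real (p x)) * k x) \<le> cmod (k x)"
        unfolding norm_mult cmod_exp_neg_mult by (intro mult_left_le_one_le) auto
    qed
    show "(\<lambda>x. exp (- z * complex_of_real (p x)) * k x) \<in> borel_measurable lborel" by measurable
    show "(\<lambda>x. exp (- w n * complex_of_real (p x)) * k x) \<in> borel_measurable lborel" for n by measurable
  qed
qed

text \<open>
  Differentiation under the integral sign. The difference quotients at \<open>z\<close> stay within the half plane
  \<open>Re w > Re z / 2 = c\<close>, where the derivative of \<open>exp (- w p)\<close> is at most \<open>p exp (- c p) \<le> 1/c\<close>.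
\<close>
lemma laplace_transform_holomorphic:
  fixes k :: "'a::euclidean_space \<Rightarrow> complex"
  assumes k: "integrable lborel k" and [measurable]: "p \<in> borel_measurable borel"
    and p: "\<And>x. p x \<ge> (0::real)"
  shows "(\<lambda>z. \<integral>x. exp (- z * complex_of_real (p x)) * k x \<partial>lborel) holomorphic_on {z. Re z > 0}"
proof -
  note [measurable] = borel_measurable_integrable[OF k]
  let ?F = "\<lambda>z. \<integral>x. exp (- z * complex_of_real (p x)) * k x \<partial>lborel"
  have int: "integrable lborel (\<lambda>x. exp (- z * complex_of_real (p x)) * k x)" if "Re z > 0" for z
  proof (rule Bochner_Integration.integrable_bound[OF k])
    have "exp (- Re z * p x) \<le> 1" for x using that p by simp
    then have "norm (exp (- z * complex_of_real (p x)) * k x) \<le> norm (k x)" for x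
      unfolding norm_mult cmod_exp_neg_mult by (intro mult_left_le_one_le) auto
    then show "AE x in lborel. norm (exp (- z * complex_of_real (p x)) * k x) \<le> norm (k x)"
      by (intro AE_I2)
  qed measurable
  have "(?F has_field_derivative (\<integral>x. - complex_of_real (p x) * exp (- z * complex_of_real (p x)) * k x \<partial>lborel)) (at z)"
    if z: "Re z > 0" for z
  proof -
    define c where "c = Re z / 2"
    define S where "S = {w. c < Re w}"
    have c: "c > 0" and zS: "z \<in> S" using z by (auto simp: c_def S_def)
    have oS: "open S" unfolding S_def by (rule open_halfspace_Re_gt)
    have cS: "convex S" unfolding S_def by (rule convex_halfspace_Re_gt)
    have quot: "cmod (exp (- w * complex_of_real (p x)) - exp (- z * complex_of_real (p x))) \<le> (1 / c) * cmod (w - z)"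
      if "w \<in> S" for w x
    proof (rule field_differentiable_bound[OF cS _ _ that zS])
      fix u assume u: "u \<in> S"
      show "((\<lambda>w. exp (- w * complex_of_real (p x))) has_field_derivative
          - complex_of_real (p x) * exp (- u * complex_of_real (p x))) (at u within S)"
        by (auto intro!: derivative_eq_intros)
      have "p x * exp (- Re u * p x) \<le> p x * exp (- c * p x)"
        using u p by (auto simp: S_def intro!: mult_left_mono mult_right_mono)
      also have "\<dots> \<le> 1 / c"
      proof -
        have "c * p x \<le> exp (c * p x)" using exp_ge_add_one_self[of "c * p x"] by linarith
        then show ?thesis using c by (simp add: exp_minus field_simps)
      qed
      finally show "cmod (- complex_of_real (p x) * exp (- u * complex_of_real (p x))) \<le> 1 / c"
        unfolding norm_mult cmod_exp_neg_mult using p[of x] by simp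
    qed
    have "((\<lambda>w. (?F w - ?F z) / (w - z)) \<longlongrightarrow> (\<integral>x. - complex_of_real (p x) * exp (- z * complex_of_real (p x)) * k x \<partial>lborel)) (at z within S)"
      unfolding tendsto_at_iff_sequentially comp_def
    proof safe
      fix w :: "nat \<Rightarrow> complex"
      assume w: "\<forall>n. w n \<in> S - {z}" and lim: "w \<longlonglongrightarrow> z"
      have wS: "w n \<in> S" "w n \<noteq> z" for n using w by auto
      have Re_w: "Re (w n) > 0" for n using wS(1)[of n] c by (simp add: S_def)
      have "(?F (w n) - ?F z) / (w n - z)
          = (\<integral>x. (exp (- w n * complex_of_real (p x)) - exp (- z * complex_of_real (p x))) / (w n - z) * k x \<partial>lborel)" for n
      proof -
        have "(?F (w n) - ?F z) / (w n - z)
            = (\<integral>x. (exp (- w n * complex_of_real (p x)) * k x - exp (- z * complex_of_real (p x)) * k x) / (w n - z) \<partial>lborel)"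
          using int[OF Re_w[of n]] int[OF z] by (simp only: integral_divide_zero Bochner_Integration.integral_diff)
        then show ?thesis by (simp add: left_diff_distrib)
      qed
      moreover have "(\<lambda>n. \<integral>x. (exp (- w n * complex_of_real (p x)) - exp (- z * complex_of_real (p x))) / (w n - z) * k x \<partial>lborel)
          \<longlonglongrightarrow> (\<integral>x. - complex_of_real (p x) * exp (- z * complex_of_real (p x)) * k x \<partial>lborel)"
      proof (rule integral_dominated_convergence[where w="\<lambda>x. (1 / c) * cmod (k x)"])
        show "integrable lborel (\<lambda>x. (1 / c) * cmod (k x))" using k by simp
        show "AE x in lborel. (\<lambda>n. (exp (- w n * complex_of_real (p x)) - exp (- z * complex_of_real (p x))) / (w n - z) * k x)
            \<longlonglongrightarrow> - complex_of_real (p x) * exp (- z * complex_of_real (p x)) * k x"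
        proof (intro AE_I2 tendsto_mult_right)
          fix x
          have "((\<lambda>w. exp (- w * complex_of_real (p x))) has_field_derivative
              - complex_of_real (p x) * exp (- z * complex_of_real (p x))) (at z within S)"
            by (auto intro!: derivative_eq_intros)
          then show "(\<lambda>n. (exp (- w n * complex_of_real (p x)) - exp (- z * complex_of_real (p x))) / (w n - z))
              \<longlonglongrightarrow> - complex_of_real (p x) * exp (- z * complex_of_real (p x))"
            unfolding has_field_derivative_iff tendsto_at_iff_sequentially comp_def using w lim by blast
        qed
        show "AE x in lborel. norm ((exp (- w n * complex_of_real (p x)) - exp (- z * complex_of_real (p x))) / (w n - z) * k x)
            \<le> (1 / c) * cmod (k x)" for n
        proof (intro AE_I2)
          fix x
          have "cmod (exp (- w n * complex_of_real (p x)) - exp (- z * complex_of_real (p x))) / cmod (w n - z) \<le> 1 / c"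
            using quot[OF wS(1)] wS(2)[of n] by (subst pos_divide_le_eq) auto
          then show "norm ((exp (- w n * complex_of_real (p x)) - exp (- z * complex_of_real (p x))) / (w n - z) * k x)
              \<le> (1 / c) * cmod (k x)"
            unfolding norm_mult norm_divide by (intro mult_right_mono) auto
        qed
        show "(\<lambda>x. - complex_of_real (p x) * exp (- z * complex_of_real (p x)) * k x) \<in> borel_measurable lborel" by measurable
        show "(\<lambda>x. (exp (- w n * complex_of_real (p x)) - exp (- z * complex_of_real (p x))) / (w n - z) * k x) \<in> borel_measurable lborel" for n
          by measurable
      qed
      ultimately show "(\<lambda>n. (?F (w n) - ?F z) / (w n - z)) \<longlonglongrightarrow> (\<integral>x. - complex_of_real (p x) * exp (- z * complex_of_real (p x)) * k x \<partial>lborel)"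
        by (simp only:)
    qed
    then have "(?F has_field_derivative (\<integral>x. - complex_of_real (p x) * exp (- z * complex_of_real (p x)) * k x \<partial>lborel)) (at z within S)"
      unfolding has_field_derivative_iff .
    then show ?thesis using at_within_open[OF zS oS] by simp
  qed
  then show ?thesis
    unfolding holomorphic_on_def field_differentiable_def using has_field_derivative_at_within by blast
qed

text \<open>
  The Gaussian formula for real \<open>\<delta>\<close> extends to complex \<open>z\<close> by the identity theorem: both sides are
  holomorphic in the right half plane, as each is a Laplace transform of an integrable function
  (in \<open>z\<close> on the left, in \<open>1/(4 z)\<close> on the right).
\<close>
lemma complex_gaussian_fourier_integral:
  fixes f :: "'a::euclidean_space \<Rightarrow> complex"
  assumes f: "integrable lborel f" and Ff: "integrable lborel (fourier_integral f)" and z: "Re z > 0"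
  shows "(\<integral>\<xi>. exp (- z * complex_of_real ((norm \<xi>)\<^sup>2)) * (cis (x \<bullet> \<xi>) * fourier_integral f \<xi>) \<partial>lborel)
     = csqrt (complex_of_real pi / z) ^ DIM('a) *
         (\<integral>y. exp (- (1 / (4 * z)) * complex_of_real ((norm (x - y))\<^sup>2)) * f y \<partial>lborel)"
proof -
  define F where "F z = (\<integral>\<xi>. exp (- z * complex_of_real ((norm \<xi>)\<^sup>2)) * (cis (x \<bullet> \<xi>) * fourier_integral f \<xi>) \<partial>lborel)" for z
  define G where "G z = (\<integral>y. exp (- z * complex_of_real ((norm (x - y))\<^sup>2)) * f y \<partial>lborel)" for z
  define H where "H z = F z - csqrt (complex_of_real pi / z) ^ DIM('a) * G (1 / (4 * z))" for z :: complex
  let ?S = "{z. Re z > 0}"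
  have Re_inv: "Re (1 / (4 * z)) > 0" "Re (complex_of_real pi / z) > 0" "z \<noteq> 0" if "Re z > 0" for z :: complex
    using that by (auto simp: Re_divide power2_eq_square intro!: divide_pos_pos add_pos_nonneg)
  have F: "F holomorphic_on ?S" unfolding F_def
    by (rule laplace_transform_holomorphic) (use Ff in \<open>auto intro!: integrable_cis_mult\<close>)
  have G: "G holomorphic_on ?S" unfolding G_def
    by (rule laplace_transform_holomorphic) (use f in auto)
  have "(\<lambda>z. G (1 / (4 * z))) holomorphic_on ?S"
    by (rule holomorphic_on_compose_gen[OF _ G, unfolded comp_def])
       (auto intro!: holomorphic_intros Re_inv)
  moreover have "(\<lambda>z. csqrt (complex_of_real pi / z)) holomorphic_on ?S"
  proof (rule holomorphic_on_compose_gen[OF _ holomorphic_on_csqrt, unfolded comp_def])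
    show "(\<lambda>z. complex_of_real pi / z) holomorphic_on ?S"
      by (intro holomorphic_intros) (use Re_inv(3) in auto)
    show "(\<lambda>z. complex_of_real pi / z) ` ?S \<subseteq> - \<real>\<^sub>\<le>\<^sub>0"
      using Re_inv(2) by (force simp: complex_nonpos_Reals_iff)
  qed
  ultimately have hol: "H holomorphic_on ?S" unfolding H_def
    by (intro holomorphic_on_diff holomorphic_on_mult holomorphic_on_power F)
  have con: "connected ?S" by (intro convex_connected convex_halfspace_Re_gt)
  have limpt: "(1::complex) islimpt complex_of_real ` {0<..}"
    unfolding islimpt_approachable
  proof safe
    fix e :: real assume "e > 0"
    then show "\<exists>x'\<in>complex_of_real ` {0<..}. x' \<noteq> 1 \<and> dist x' 1 < e"
    proof (intro bexI[of _ "complex_of_real (1 + e / 2)"] conjI)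
      assume e: "e > 0"
      show "complex_of_real (1 + e / 2) \<noteq> 1" using e by simp
      show "dist (complex_of_real (1 + e / 2)) 1 < e" using e by (simp add: dist_norm)
      show "complex_of_real (1 + e / 2) \<in> complex_of_real ` {0<..}" using e by (intro imageI) simp
    qed
  qed
  have zero: "H w = 0" if "w \<in> complex_of_real ` {0<..}" for w
  proof -
    from that obtain \<delta> where d: "\<delta> > 0" and w: "w = complex_of_real \<delta>" by auto
    have "F w = (\<integral>\<xi>. complex_of_real (exp (- \<delta> * (norm \<xi>)\<^sup>2)) * cis (x \<bullet> \<xi>) * fourier_integral f \<xi> \<partial>lborel)"
      unfolding F_def w by (simp add: mult.assoc exp_of_real[symmetric])
    also have "\<dots> = complex_of_real (sqrt (pi / \<delta>) ^ DIM('a)) *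
         (\<integral>y. complex_of_real (exp (- (norm (x - y))\<^sup>2 / (4 * \<delta>))) * f y \<partial>lborel)"
      by (rule integral_gaussian_fourier_integral[OF f d])
    also have "(\<integral>y. complex_of_real (exp (- (norm (x - y))\<^sup>2 / (4 * \<delta>))) * f y \<partial>lborel) = G (1 / (4 * w))"
      unfolding G_def w by (simp add: exp_of_real[symmetric])
    also have "complex_of_real (sqrt (pi / \<delta>) ^ DIM('a)) = csqrt (complex_of_real pi / w) ^ DIM('a)"
      unfolding w using d by (simp add: csqrt_of_real_nonneg flip: of_real_divide)
    finally show ?thesis unfolding H_def by simp
  qed
  have "H z = 0"
    by (rule analytic_continuation[OF hol open_halfspace_Re_gt con _ _ limpt zero]) (use z in auto)
  then show ?thesis unfolding H_def F_def G_def by simp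
qed

text \<open>
  The limit \<open>z \<rightarrow> i T\<close> from inside the right half plane; both Laplace transforms are continuous up to
  the imaginary axis.
\<close>
lemma schroedinger_kernel:
  fixes f :: "'a::euclidean_space \<Rightarrow> complex"
  assumes f: "integrable lborel f" and Ff: "integrable lborel (fourier_integral f)" and T: "T > 0"
  shows "(\<integral>\<xi>. cis (- T * (norm \<xi>)\<^sup>2) * (cis (x \<bullet> \<xi>) * fourier_integral f \<xi>) \<partial>lborel)
     = csqrt (complex_of_real pi / (\<i> * T)) ^ DIM('a) * (\<integral>y. cis ((norm (x - y))\<^sup>2 / (4 * T)) * f y \<partial>lborel)"
proof -
  define F where "F z = (\<integral>\<xi>. exp (- z * complex_of_real ((norm \<xi>)\<^sup>2)) * (cis (x \<bullet> \<xi>) * fourier_integral f \<xi>) \<partial>lborel)" for z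
  define G where "G z = (\<integral>y. exp (- z * complex_of_real ((norm (x - y))\<^sup>2)) * f y \<partial>lborel)" for z
  define z where "z k = Complex (1 / real (Suc k)) T" for k
  have zlim: "z \<longlonglongrightarrow> Complex 0 T"
    unfolding z_def using LIMSEQ_inverse_real_of_nat
    by (intro tendsto_Complex tendsto_const) (simp add: inverse_eq_divide)
  also have iT: "Complex 0 T = \<i> * T" by (simp add: complex_eq_iff)
  finally have zlim: "z \<longlonglongrightarrow> \<i> * T" .
  have Re_z: "Re (z k) > 0" for k by (simp add: z_def)
  have Re_inv: "Re (1 / (4 * z k)) > 0" for k
    using Re_z[of k] by (auto simp: Re_divide intro!: divide_pos_pos add_pos_nonneg)
  have iT0: "\<i> * complex_of_real T \<noteq> 0" using T by simp
  have F: "continuous_on {z. Re z \<ge> 0} F" unfolding F_def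
    by (rule laplace_transform_continuous) (use Ff in \<open>auto intro!: integrable_cis_mult\<close>)
  have G: "continuous_on {z. Re z \<ge> 0} G" unfolding G_def
    by (rule laplace_transform_continuous) (use f in auto)
  have 1: "(\<lambda>k. F (z k)) \<longlonglongrightarrow> F (\<i> * T)"
    by (rule continuous_on_tendsto_compose[OF F zlim]) (auto simp: Re_z less_imp_le)
  have 2: "(\<lambda>k. G (1 / (4 * z k))) \<longlonglongrightarrow> G (1 / (4 * (\<i> * T)))"
  proof (rule continuous_on_tendsto_compose[OF G])
    show "(\<lambda>k. 1 / (4 * z k)) \<longlonglongrightarrow> 1 / (4 * (\<i> * complex_of_real T))"
      using iT0 by (intro tendsto_intros zlim) auto
    show "1 / (4 * (\<i> * complex_of_real T)) \<in> {z. 0 \<le> Re z}" by (simp add: Re_divide)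
    show "\<forall>\<^sub>F k in sequentially. 1 / (4 * z k) \<in> {z. 0 \<le> Re z}"
      by (intro always_eventually allI) (use Re_inv in \<open>simp add: less_imp_le\<close>)
  qed
  have 3: "(\<lambda>k. csqrt (complex_of_real pi / z k)) \<longlonglongrightarrow> csqrt (complex_of_real pi / (\<i> * T))"
  proof (rule isCont_tendsto_compose[where g=csqrt])
    show "isCont csqrt (complex_of_real pi / (\<i> * T))"
      using T by (intro continuous_at_csqrt) (auto simp: complex_nonpos_Reals_iff Im_divide)
    show "(\<lambda>k. complex_of_real pi / z k) \<longlonglongrightarrow> complex_of_real pi / (\<i> * complex_of_real T)"
      using iT0 by (intro tendsto_intros zlim)
  qed
  have "F (z k) = csqrt (complex_of_real pi / z k) ^ DIM('a) * G (1 / (4 * z k))" for k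
    unfolding F_def G_def by (rule complex_gaussian_fourier_integral[OF f Ff Re_z])
  with 1 have "(\<lambda>k. csqrt (complex_of_real pi / z k) ^ DIM('a) * G (1 / (4 * z k))) \<longlonglongrightarrow> F (\<i> * T)" by simp
  moreover have "(\<lambda>k. csqrt (complex_of_real pi / z k) ^ DIM('a) * G (1 / (4 * z k)))
      \<longlonglongrightarrow> csqrt (complex_of_real pi / (\<i> * T)) ^ DIM('a) * G (1 / (4 * (\<i> * T)))"
    by (intro tendsto_intros 2 3)
  ultimately have "F (\<i> * T) = csqrt (complex_of_real pi / (\<i> * T)) ^ DIM('a) * G (1 / (4 * (\<i> * T)))"
    by (rule LIMSEQ_unique)
  moreover have "exp (- (\<i> * complex_of_real T) * complex_of_real s) = cis (- T * s)" for s
    by (simp add: cis_conv_exp mult.assoc)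
  moreover have "exp (- (1 / (4 * (\<i> * complex_of_real T))) * complex_of_real s) = cis (s / (4 * T))" for s
  proof -
    have "- (1 / (4 * (\<i> * complex_of_real T))) * complex_of_real s = \<i> * complex_of_real (s / (4 * T))"
      using T by (simp add: complex_eq_iff Re_divide Im_divide power2_eq_square)
    then show ?thesis by (simp only: cis_conv_exp)
  qed
  ultimately show ?thesis unfolding F_def G_def by (simp only:)
qed

lemma powr_half_real_nat: "x > 0 \<Longrightarrow> x powr (real n / 2) = sqrt x ^ n"
  by (simp add: powr_half_sqrt[symmetric] powr_powr powr_realpow[symmetric])

text \<open>
  Modulation by the quadratic phase that remains in the Schroedinger kernel after \<open>|x - y|\<^sup>2\<close> has been
  expanded.
\<close>
definition chirp :: "real \<Rightarrow> (real^'n \<Rightarrow> complex) \<Rightarrow> real^'n \<Rightarrow> complex" where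
  "chirp T f y = cis ((norm y)\<^sup>2 / (4 * T)) * f y"

text \<open>
  In \<open>|x - y|\<^sup>2 = |x|\<^sup>2 - 2 x \<bullet> y + |y|\<^sup>2\<close> the first term contributes a phase, the second the frequency
  \<open>x / (2 T)\<close>, the third the chirp.
\<close>
lemma cmod_schroedinger_group:
  fixes f :: "real^'n \<Rightarrow> complex"
  assumes f: "f \<in> test_functions" and T: "T > 0"
  shows "cmod (schroedinger_group T f x)
     = (1 / sqrt (4 * pi * T)) ^ CARD('n) * cmod (fourier_integral (chirp T f) (x /\<^sub>R (2 * T)))"
proof -
  let ?n = "CARD('n)"
  note fi = compactly_supported_integrable[OF C1_compactD(1)[OF test_function_C1_compact[OF f]]]
  have pw: "(2 * pi) powr (real ?n / 2) = sqrt (2 * pi) ^ ?n"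
    by (simp add: powr_half_real_nat)
  have fourier: "fourier f \<xi> = complex_of_real (1 / sqrt (2 * pi) ^ ?n) * fourier_integral f \<xi>" for \<xi>
    unfolding fourier_def fourier_integral_def pw by (simp add: scaleR_conv_of_real)
  have "schroedinger_group T f x = complex_of_real (1 / sqrt (2 * pi) ^ ?n) *
      (\<integral>\<xi>. complex_of_real (1 / sqrt (2 * pi) ^ ?n) * (cis (- T * (norm \<xi>)\<^sup>2) * (cis (x \<bullet> \<xi>) * fourier_integral f \<xi>)) \<partial>lborel)"
    unfolding schroedinger_group_def inverse_fourier_def pw fourier
    by (simp add: scaleR_conv_of_real mult_ac)
  also have "\<dots> = complex_of_real (1 / sqrt (2 * pi) ^ ?n * (1 / sqrt (2 * pi) ^ ?n)) *
      (csqrt (complex_of_real pi / (\<i> * T)) ^ ?n * (\<integral>y. cis ((norm (x - y))\<^sup>2 / (4 * T)) * f y \<partial>lborel))"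
    unfolding integral_mult_right_zero schroedinger_kernel[OF fi test_function_fourier_integrable(1)[OF f] T] by simp
  also have "(\<integral>y. cis ((norm (x - y))\<^sup>2 / (4 * T)) * f y \<partial>lborel)
      = cis ((norm x)\<^sup>2 / (4 * T)) * fourier_integral (chirp T f) (x /\<^sub>R (2 * T))"
  proof -
    have "cis ((norm (x - y))\<^sup>2 / (4 * T)) = cis ((norm x)\<^sup>2 / (4 * T)) * (cis (- (y \<bullet> (x /\<^sub>R (2 * T)))) * cis ((norm y)\<^sup>2 / (4 * T)))" for y
    proof -
      have "(norm (x - y))\<^sup>2 / (4 * T) = (norm x)\<^sup>2 / (4 * T) + (- (y \<bullet> (x /\<^sub>R (2 * T))) + (norm y)\<^sup>2 / (4 * T))"
        using T by (simp add: power2_norm_eq_inner inner_diff_left inner_diff_right inner_commute field_simps)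
      then show ?thesis by (simp only: cis_mult)
    qed
    then show ?thesis unfolding fourier_integral_def chirp_def
      by (simp add: mult.assoc)
  qed
  finally have "cmod (schroedinger_group T f x) = (1 / sqrt (2 * pi) ^ ?n * (1 / sqrt (2 * pi) ^ ?n)) * sqrt (pi / T) ^ ?n
      * cmod (fourier_integral (chirp T f) (x /\<^sub>R (2 * T)))"
    using T by (simp add: norm_mult norm_divide norm_power)
  also have "(1 / sqrt (2 * pi) ^ ?n * (1 / sqrt (2 * pi) ^ ?n)) * sqrt (pi / T) ^ ?n
      = (1 / sqrt (2 * pi) * (1 / sqrt (2 * pi)) * sqrt (pi / T)) ^ ?n"
    by (simp only: power_mult_distrib power_one_over)
  also have "1 / sqrt (2 * pi) * (1 / sqrt (2 * pi)) * sqrt (pi / T) = 1 / sqrt (4 * pi * T)"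
  proof -
    have "sqrt (pi / T) / (2 * pi) = 1 / sqrt (4 * pi * T)"
    proof (rule power2_eq_imp_eq)
      show "(sqrt (pi / T) / (2 * pi))\<^sup>2 = (1 / sqrt (4 * pi * T))\<^sup>2"
        using T by (simp add: power_divide power2_eq_square field_simps)
    qed (use T in auto)
    then show ?thesis by (simp add: field_simps)
  qed
  finally show ?thesis .
qed

section \<open>Mass and second moment of the evolution\<close>

lemma compactly_supported_integrable_weighted:
  fixes w :: "'a::euclidean_space \<Rightarrow> real"
  assumes f: "f \<in> compactly_supported" and w: "continuous_on UNIV w"
  shows "integrable lborel (\<lambda>x. w x * (cmod (f x))\<^sup>2)"
    and "integrable lborel (\<lambda>x. w x * cmod (f x))"
proof -
  have c: "(\<lambda>x. (complex_of_real (w x) * cnj (f x)) * f x) \<in> compactly_supported"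
    by (rule compactly_supported_mult[OF f])
       (intro continuous_intros w compactly_supported_continuous[OF f])
  have "integrable lborel (\<lambda>x. complex_of_real (w x * (cmod (f x))\<^sup>2))"
    using compactly_supported_integrable[OF c]
    by (simp add: complex_norm_square mult_ac del: of_real_power)
  then show "integrable lborel (\<lambda>x. w x * (cmod (f x))\<^sup>2)"
    by (simp only: complex_of_real_integrable_eq)
  have "(\<lambda>x. complex_of_real (w x) * f x) \<in> compactly_supported"
    by (rule compactly_supported_mult[OF f]) (intro continuous_intros w)
  from integrable_norm[OF compactly_supported_integrable[OF this]]
  have "integrable lborel (\<lambda>x. \<bar>w x\<bar> * cmod (f x))" by (simp add: norm_mult)
  then show "integrable lborel (\<lambda>x. w x * cmod (f x))"
    by (rule Bochner_Integration.integrable_bound)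
       (use compactly_supported_measurable[OF f] borel_measurable_continuous_onI[OF w] in \<open>auto simp: abs_mult\<close>)
qed

text \<open>
  Plancherel for the partial derivatives, summed over an orthonormal basis.
\<close>
lemma
  fixes f :: "'a::euclidean_space \<Rightarrow> complex"
  assumes f: "f \<in> C1_compact"
  shows dirichlet_integrable: "integrable lborel (\<lambda>\<xi>. (norm \<xi>)\<^sup>2 * (cmod (fourier_integral f \<xi>))\<^sup>2)"
    and dirichlet_plancherel: "(\<integral>\<xi>. (norm \<xi>)\<^sup>2 * (cmod (fourier_integral f \<xi>))\<^sup>2 \<partial>lborel)
      = (2 * pi) ^ DIM('a) * (\<Sum>b\<in>Basis. \<integral>x. (cmod (frechet_derivative f (at x) b))\<^sup>2 \<partial>lborel)"
proof -
  let ?D = "\<lambda>b x. frechet_derivative f (at x) b"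
  have eq: "(norm \<xi>)\<^sup>2 * (cmod (fourier_integral f \<xi>))\<^sup>2 = (\<Sum>b\<in>Basis. (cmod (fourier_integral (?D b) \<xi>))\<^sup>2)" for \<xi>
    unfolding norm_power2_eq_sum_Basis[of \<xi>] fourier_integral_frechet_derivative[OF f] sum_distrib_right
    by (intro sum.cong refl) (simp add: norm_mult power_mult_distrib inner_commute)
  note pl = compactly_supported_frechet_derivative[OF f]
  show "integrable lborel (\<lambda>\<xi>. (norm \<xi>)\<^sup>2 * (cmod (fourier_integral f \<xi>))\<^sup>2)"
    unfolding eq by (intro Bochner_Integration.integrable_sum plancherel_integrable pl)
  show "(\<integral>\<xi>. (norm \<xi>)\<^sup>2 * (cmod (fourier_integral f \<xi>))\<^sup>2 \<partial>lborel)
      = (2 * pi) ^ DIM('a) * (\<Sum>b\<in>Basis. \<integral>x. (cmod (?D b x))\<^sup>2 \<partial>lborel)"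
    unfolding eq by (subst Bochner_Integration.integral_sum)
      (simp_all add: plancherel_integrable pl plancherel sum_distrib_left)
qed

lemma chirp_derivative: "((\<lambda>y. (norm y)\<^sup>2 / (4 * T)) has_derivative (\<lambda>v. (y \<bullet> v) / (2 * T))) (at y)"
  for y :: "'a::euclidean_space"
  unfolding power2_norm_eq_inner divide_inverse
  by (auto intro!: derivative_eq_intros simp: inner_commute fun_eq_iff)

lemma chirp_C1_compact:
  assumes f: "f \<in> C1_compact"
  shows "chirp T f \<in> C1_compact"
  unfolding chirp_def[abs_def]
proof (rule C1_compact_cis_mult[OF f chirp_derivative[of T]])
  show "continuous_on UNIV (\<lambda>x. x \<bullet> v / (2 * T))" for v :: "real^'a"
    unfolding divide_inverse
    by (intro continuous_on_mult continuous_on_inner continuous_on_id continuous_on_const)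
qed

lemma cmod_chirp [simp]: "cmod (chirp T f y) = cmod (f y)"
  by (simp add: chirp_def norm_mult)

text \<open>
  The product rule gives \<open>2 T |D\<^sub>b g| \<le> 2 T |D\<^sub>b f| + |y \<bullet> b| |f|\<close> for the chirped function \<open>g\<close>; square it
  with \<open>(s + t)\<^sup>2 \<le> 2 s\<^sup>2 + 2 t\<^sup>2\<close>.
\<close>
lemma cmod_chirp_derivative_le:
  assumes f: "f \<in> C1_compact" and T: "T > 0"
  shows "4 * T\<^sup>2 * (cmod (frechet_derivative (chirp T f) (at y) b))\<^sup>2
    \<le> 8 * T\<^sup>2 * (cmod (frechet_derivative f (at y) b))\<^sup>2 + 2 * (y \<bullet> b)\<^sup>2 * (cmod (f y))\<^sup>2"
proof -
  let ?D = "frechet_derivative f (at y) b"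
  have "frechet_derivative (chirp T f) (at y) b
     = cis ((norm y)\<^sup>2 / (4 * T)) * (?D + \<i> * ((y \<bullet> b) / (2 * T)) * f y)"
    unfolding chirp_def[abs_def] using frechet_derivative_cis_mult[OF chirp_derivative C1_compactD(2)[OF f]]
    by (simp add: mult.assoc)
  then have "cmod (frechet_derivative (chirp T f) (at y) b) \<le> cmod ?D + \<bar>y \<bullet> b\<bar> / (2 * T) * cmod (f y)"
    using norm_triangle_ineq[of ?D "\<i> * ((y \<bullet> b) / (2 * T)) * f y"] T by (simp add: norm_mult norm_divide)
  then have "(cmod (frechet_derivative (chirp T f) (at y) b))\<^sup>2 \<le> (cmod ?D + \<bar>y \<bullet> b\<bar> / (2 * T) * cmod (f y))\<^sup>2"
    by (intro power_mono) auto
  also have "\<dots> \<le> 2 * (cmod ?D)\<^sup>2 + 2 * (\<bar>y \<bullet> b\<bar> / (2 * T) * cmod (f y))\<^sup>2"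
    using sum_squares_bound[of "cmod ?D" "\<bar>y \<bullet> b\<bar> / (2 * T) * cmod (f y)"]
    by (simp add: power2_sum)
  finally have "4 * T\<^sup>2 * (cmod (frechet_derivative (chirp T f) (at y) b))\<^sup>2
     \<le> 4 * T\<^sup>2 * (2 * (cmod ?D)\<^sup>2 + 2 * (\<bar>y \<bullet> b\<bar> / (2 * T) * cmod (f y))\<^sup>2)"
    by (intro mult_left_mono) auto
  also have "\<dots> = 8 * T\<^sup>2 * (cmod ?D)\<^sup>2 + 2 * (y \<bullet> b)\<^sup>2 * (cmod (f y))\<^sup>2"
    using T by (simp add: power_mult_distrib power_divide field_simps)
  finally show ?thesis .
qed

text \<open>
  On the Fourier side this is \<open>|\<xi>|\<^sup>2 \<le> (1 + |\<xi>|\<^sup>2) ^ (k + 1)\<close>.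
\<close>
lemma sobolev_norm_ge:
  fixes f :: "real^'n \<Rightarrow> complex"
  assumes f: "f \<in> test_functions"
  shows "(\<Sum>b\<in>Basis. \<integral>x. (cmod (frechet_derivative f (at x) b))\<^sup>2 \<partial>lborel) \<le> (sobolev_norm (Suc k) f)\<^sup>2"
proof -
  let ?n = "CARD('n)"
  note f1 = test_function_C1_compact[OF f]
  have pw: "((2 * pi) powr (real ?n / 2))\<^sup>2 = (2 * pi) ^ ?n"
  proof -
    have "(sqrt (2 * pi) ^ ?n)\<^sup>2 = ((sqrt (2 * pi))\<^sup>2) ^ ?n" by (metis power_mult mult.commute)
    then show ?thesis by (simp add: powr_half_real_nat)
  qed
  have F: "(cmod (fourier f \<xi>))\<^sup>2 = 1 / (2 * pi) ^ ?n * (cmod (fourier_integral f \<xi>))\<^sup>2" for \<xi>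
    unfolding fourier_def fourier_integral_def norm_scaleR power_mult_distrib
    by (simp add: power_divide pw)
  have le: "(norm \<xi>)\<^sup>2 \<le> (1 + (norm \<xi>)\<^sup>2) ^ Suc k" for \<xi> :: "real^'n"
    using self_le_power[of "1 + (norm \<xi>)\<^sup>2" "Suc k"] by simp
  have "(2 * pi) ^ ?n * (\<Sum>b\<in>Basis. \<integral>x. (cmod (frechet_derivative f (at x) b))\<^sup>2 \<partial>lborel)
      = (\<integral>\<xi>. (norm \<xi>)\<^sup>2 * (cmod (fourier_integral f \<xi>))\<^sup>2 \<partial>lborel)"
    using dirichlet_plancherel[OF f1] by simp
  also have "\<dots> \<le> (\<integral>\<xi>. (1 + (norm \<xi>)\<^sup>2) ^ Suc k * (cmod (fourier_integral f \<xi>))\<^sup>2 \<partial>lborel)"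
    by (intro integral_mono dirichlet_integrable f1 test_function_fourier_integrable f mult_right_mono le) simp
  also have "\<dots> = (2 * pi) ^ ?n * (sobolev_norm (Suc k) f)\<^sup>2"
  proof -
    have "(sobolev_norm (Suc k) f)\<^sup>2 = (\<integral>\<xi>. (1 + (norm \<xi>)\<^sup>2) ^ Suc k * (cmod (fourier f \<xi>))\<^sup>2 \<partial>lborel)"
      unfolding sobolev_norm_def by (intro real_sqrt_pow2 integral_nonneg_AE AE_I2) simp
    also have "\<dots> = 1 / (2 * pi) ^ ?n * (\<integral>\<xi>. (1 + (norm \<xi>)\<^sup>2) ^ Suc k * (cmod (fourier_integral f \<xi>))\<^sup>2 \<partial>lborel)"
      unfolding F integral_mult_right_zero[symmetric] by (simp add: mult_ac)
    finally show ?thesis by simp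
  qed
  finally show ?thesis by simp
qed

text \<open>
  Mass and second moment follow by Plancherel from the representation of \<open>|u|\<close> as a dilated Fourier transform of the
  chirped datum \<open>g\<close>: the dilation by \<open>2 T\<close> turns \<open>|x|\<^sup>2 |u|\<^sup>2\<close> into \<open>4 T\<^sup>2 |\<xi>|\<^sup>2\<close> times the squared transform of \<open>g\<close>,
  hence into the gradient of \<open>g\<close>.
\<close>
lemma
  fixes f :: "real^'n \<Rightarrow> complex"
  assumes f: "f \<in> test_functions" and T: "T > 0"
  shows schroedinger_mass_integrable: "integrable lborel (\<lambda>x. (cmod (schroedinger_group T f x))\<^sup>2)"
    and schroedinger_mass: "(\<integral>x. (cmod (schroedinger_group T f x))\<^sup>2 \<partial>lborel) = (\<integral>x. (cmod (f x))\<^sup>2 \<partial>lborel)"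
    and schroedinger_moment_integrable: "integrable lborel (\<lambda>x. (norm x)\<^sup>2 * (cmod (schroedinger_group T f x))\<^sup>2)"
    and schroedinger_moment: "(\<integral>x. (norm x)\<^sup>2 * (cmod (schroedinger_group T f x))\<^sup>2 \<partial>lborel)
       \<le> 8 * T\<^sup>2 * (sobolev_norm (Suc k) f)\<^sup>2 + 2 * (\<integral>y. (norm y)\<^sup>2 * (cmod (f y))\<^sup>2 \<partial>lborel)"
proof -
  let ?n = "CARD('n)"
  let ?c = "1 / (4 * pi * T)"
  note f1 = test_function_C1_compact[OF f]
  note g1 = chirp_C1_compact[OF f1, of T]
  note g = C1_compactD(1)[OF g1]
  note [measurable] = compactly_supported_measurable[OF g]
  define P where "P \<xi> = (cmod (fourier_integral (chirp T f) \<xi>))\<^sup>2" for \<xi>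
  have [measurable]: "P \<in> borel_measurable borel" unfolding P_def by measurable
  have u: "(cmod (schroedinger_group T f x))\<^sup>2 = ?c ^ ?n * P (0 + (1 / (2 * T)) *\<^sub>R x)" for x
  proof -
    have "(1 / sqrt (4 * pi * T))\<^sup>2 = ?c" using T by (simp add: power_divide)
    then have "((1 / sqrt (4 * pi * T)) ^ ?n)\<^sup>2 = ?c ^ ?n" by (metis power_mult mult.commute)
    then show ?thesis
      unfolding cmod_schroedinger_group[OF f T] P_def power_mult_distrib by (simp add: inverse_eq_divide)
  qed
  have xu: "(norm x)\<^sup>2 * (cmod (schroedinger_group T f x))\<^sup>2
      = 4 * T\<^sup>2 * ?c ^ ?n * (\<lambda>\<xi>. (norm \<xi>)\<^sup>2 * P \<xi>) (0 + (1 / (2 * T)) *\<^sub>R x)" for x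
    unfolding u using T by (simp add: power_divide field_simps)
  have scale: "(\<integral>x. h (0 + (1 / (2 * T)) *\<^sub>R x) \<partial>lborel) = (2 * T) ^ ?n * (\<integral>x. h x \<partial>lborel)"
    if [measurable]: "h \<in> borel_measurable borel" for h :: "real^'n \<Rightarrow> real"
    using lborel_integral_affine[OF that, of "1 / (2 * T)" 0] T by (simp add: power_divide field_simps)
  have const: "?c ^ ?n * (2 * T) ^ ?n * (2 * pi) ^ ?n = 1"
    using T unfolding power_mult_distrib[symmetric] by simp
  have int: "integrable lborel P" unfolding P_def by (rule plancherel_integrable[OF g])
  have int2: "integrable lborel (\<lambda>\<xi>. (norm \<xi>)\<^sup>2 * P \<xi>)" unfolding P_def by (rule dirichlet_integrable[OF g1])
  have T': "1 / (2 * T) \<noteq> 0" using T by simp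
  show "integrable lborel (\<lambda>x. (cmod (schroedinger_group T f x))\<^sup>2)"
    unfolding u using lborel_integrable_affine_iff[OF _ T', of P 0] int by simp
  show "integrable lborel (\<lambda>x. (norm x)\<^sup>2 * (cmod (schroedinger_group T f x))\<^sup>2)"
    unfolding xu using lborel_integrable_affine_iff[OF _ T', of "\<lambda>\<xi>. (norm \<xi>)\<^sup>2 * P \<xi>" 0] int2
    by (intro integrable_mult_right) simp
  have "(\<integral>x. (cmod (schroedinger_group T f x))\<^sup>2 \<partial>lborel) = ?c ^ ?n * ((2 * T) ^ ?n * (\<integral>x. P x \<partial>lborel))"
    unfolding u integral_mult_right_zero by (subst scale) simp_all
  also have "(\<integral>x. P x \<partial>lborel) = (2 * pi) ^ ?n * (\<integral>x. (cmod (f x))\<^sup>2 \<partial>lborel)"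
    unfolding P_def plancherel[OF g] by simp
  finally show "(\<integral>x. (cmod (schroedinger_group T f x))\<^sup>2 \<partial>lborel) = (\<integral>x. (cmod (f x))\<^sup>2 \<partial>lborel)"
    unfolding mult.assoc[symmetric] const by simp
  let ?Df = "\<lambda>b x. (cmod (frechet_derivative f (at x) b))\<^sup>2"
  let ?Dg = "\<lambda>b x. (cmod (frechet_derivative (chirp T f) (at x) b))\<^sup>2"
  have "(\<integral>x. (norm x)\<^sup>2 * (cmod (schroedinger_group T f x))\<^sup>2 \<partial>lborel)
      = 4 * T\<^sup>2 * (?c ^ ?n * (2 * T) ^ ?n * (\<integral>\<xi>. (norm \<xi>)\<^sup>2 * P \<xi> \<partial>lborel))"
    unfolding xu integral_mult_right_zero by (subst scale) (simp_all only: mult.assoc, measurable)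
  also have "(\<integral>\<xi>. (norm \<xi>)\<^sup>2 * P \<xi> \<partial>lborel) = (2 * pi) ^ ?n * (\<Sum>b\<in>Basis. \<integral>x. ?Dg b x \<partial>lborel)"
    unfolding P_def dirichlet_plancherel[OF g1] by simp
  also have "4 * T\<^sup>2 * (?c ^ ?n * (2 * T) ^ ?n * ((2 * pi) ^ ?n * (\<Sum>b\<in>Basis. \<integral>x. ?Dg b x \<partial>lborel)))
      = (\<Sum>b\<in>Basis. \<integral>x. 4 * T\<^sup>2 * ?Dg b x \<partial>lborel)"
    unfolding mult.assoc[symmetric] using const by (simp add: sum_distrib_left mult.assoc)
  also have "\<dots> \<le> (\<Sum>b\<in>Basis. \<integral>x. 8 * T\<^sup>2 * ?Df b x + 2 * (x \<bullet> b)\<^sup>2 * (cmod (f x))\<^sup>2 \<partial>lborel)"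
  proof (intro sum_mono integral_mono)
    fix b :: "real^'n"
    show "integrable lborel (\<lambda>x. 4 * T\<^sup>2 * ?Dg b x)"
      by (rule compactly_supported_integrable_weighted(1)[OF compactly_supported_frechet_derivative[OF g1]]) simp
    have "integrable lborel (\<lambda>x. 8 * T\<^sup>2 * ?Df b x)"
      by (rule compactly_supported_integrable_weighted(1)[OF compactly_supported_frechet_derivative[OF f1]]) simp
    moreover have "integrable lborel (\<lambda>x. 2 * (x \<bullet> b)\<^sup>2 * (cmod (f x))\<^sup>2)"
      by (rule compactly_supported_integrable_weighted(1)[OF C1_compactD(1)[OF f1]]) (intro continuous_intros)
    ultimately show "integrable lborel (\<lambda>x. 8 * T\<^sup>2 * ?Df b x + 2 * (x \<bullet> b)\<^sup>2 * (cmod (f x))\<^sup>2)" by simp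
    show "4 * T\<^sup>2 * ?Dg b x \<le> 8 * T\<^sup>2 * ?Df b x + 2 * (x \<bullet> b)\<^sup>2 * (cmod (f x))\<^sup>2" for x
      by (rule cmod_chirp_derivative_le[OF f1 T])
  qed
  also have "\<dots> = (\<Sum>b\<in>Basis. 8 * T\<^sup>2 * (\<integral>x. ?Df b x \<partial>lborel) + (\<integral>x. 2 * (x \<bullet> b)\<^sup>2 * (cmod (f x))\<^sup>2 \<partial>lborel))"
  proof (intro sum.cong refl)
    fix b :: "real^'n"
    have "integrable lborel (\<lambda>x. 8 * T\<^sup>2 * ?Df b x)"
      by (rule compactly_supported_integrable_weighted(1)[OF compactly_supported_frechet_derivative[OF f1]]) simp
    moreover have "integrable lborel (\<lambda>x. 2 * (x \<bullet> b)\<^sup>2 * (cmod (f x))\<^sup>2)"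
      by (rule compactly_supported_integrable_weighted(1)[OF C1_compactD(1)[OF f1]]) (intro continuous_intros)
    ultimately show "(\<integral>x. 8 * T\<^sup>2 * ?Df b x + 2 * (x \<bullet> b)\<^sup>2 * (cmod (f x))\<^sup>2 \<partial>lborel)
       = 8 * T\<^sup>2 * (\<integral>x. ?Df b x \<partial>lborel) + (\<integral>x. 2 * (x \<bullet> b)\<^sup>2 * (cmod (f x))\<^sup>2 \<partial>lborel)"
      by (simp only: Bochner_Integration.integral_add integral_mult_right_zero)
  qed
  also have "\<dots> = 8 * T\<^sup>2 * (\<Sum>b\<in>Basis. \<integral>x. ?Df b x \<partial>lborel) + (\<Sum>b\<in>Basis. \<integral>x. 2 * (x \<bullet> b)\<^sup>2 * (cmod (f x))\<^sup>2 \<partial>lborel)"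
    by (simp only: sum.distrib sum_distrib_left)
  also have "(\<Sum>b\<in>Basis. \<integral>x. 2 * (x \<bullet> b)\<^sup>2 * (cmod (f x))\<^sup>2 \<partial>lborel) = (\<integral>x. 2 * ((norm x)\<^sup>2 * (cmod (f x))\<^sup>2) \<partial>lborel)"
  proof (subst Bochner_Integration.integral_sum[symmetric])
    show "integrable lborel (\<lambda>x. 2 * (x \<bullet> b)\<^sup>2 * (cmod (f x))\<^sup>2)" for b
      by (rule compactly_supported_integrable_weighted(1)[OF C1_compactD(1)[OF f1]]) (intro continuous_intros)
    show "(\<integral>x. (\<Sum>b\<in>Basis. 2 * (x \<bullet> b)\<^sup>2 * (cmod (f x))\<^sup>2) \<partial>lborel) = (\<integral>x. 2 * ((norm x)\<^sup>2 * (cmod (f x))\<^sup>2) \<partial>lborel)"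
      unfolding norm_power2_eq_sum_Basis[where 'a="real^'n"] by (simp only: sum_distrib_left sum_distrib_right mult.assoc)
  qed
  also have "8 * T\<^sup>2 * (\<Sum>b\<in>Basis. \<integral>x. ?Df b x \<partial>lborel) \<le> 8 * T\<^sup>2 * (sobolev_norm (Suc k) f)\<^sup>2"
    by (intro mult_left_mono sobolev_norm_ge f) simp
  finally show "(\<integral>x. (norm x)\<^sup>2 * (cmod (schroedinger_group T f x))\<^sup>2 \<partial>lborel)
       \<le> 8 * T\<^sup>2 * (sobolev_norm (Suc k) f)\<^sup>2 + 2 * (\<integral>y. (norm y)\<^sup>2 * (cmod (f y))\<^sup>2 \<partial>lborel)"
    by simp
qed

text \<open>
  Chebyshev's inequality for the second moment, after \<open>|y|\<^sup>2 \<le> (2/a\<^sup>2) exp (a |y|)\<close>.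
\<close>
lemma schroedinger_tail:
  fixes f :: "real^'n \<Rightarrow> complex"
  assumes f: "f \<in> test_functions" and T: "T > 0" and a: "a > 0" and R: "R > 0"
  shows "(\<integral>x. (cmod (f x))\<^sup>2 \<partial>lborel) \<le> (LINT x:cball 0 R|lborel. (cmod (schroedinger_group T f x))\<^sup>2)
     + (8 * T\<^sup>2 * (sobolev_norm (Suc k) f)\<^sup>2 + 4 / a\<^sup>2 * (\<integral>x. exp (a * norm x) * (cmod (f x))\<^sup>2 \<partial>lborel)) / R\<^sup>2"
proof -
  let ?u = "\<lambda>x. (cmod (schroedinger_group T f x))\<^sup>2"
  note fc = C1_compactD(1)[OF test_function_C1_compact[OF f]]
  have i1: "integrable lborel (\<lambda>x. indicator (cball 0 R) x * ?u x)"
    using integrable_mult_indicator[OF _ schroedinger_mass_integrable[OF f T], of "cball 0 R"] by simp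
  have i2: "integrable lborel (\<lambda>x. (norm x)\<^sup>2 * ?u x / R\<^sup>2)"
    using schroedinger_moment_integrable[OF f T] by simp
  have "(\<integral>x. (cmod (f x))\<^sup>2 \<partial>lborel) = (\<integral>x. ?u x \<partial>lborel)"
    using schroedinger_mass[OF f T] by simp
  also have "\<dots> \<le> (\<integral>x. indicator (cball 0 R) x * ?u x + (norm x)\<^sup>2 * ?u x / R\<^sup>2 \<partial>lborel)"
  proof (rule integral_mono[OF schroedinger_mass_integrable[OF f T] Bochner_Integration.integrable_add[OF i1 i2]])
    fix x :: "real^'n"
    show "?u x \<le> indicator (cball 0 R) x * ?u x + (norm x)\<^sup>2 * ?u x / R\<^sup>2"
    proof (cases "norm x \<le> R")
      case False
      then have "R\<^sup>2 \<le> (norm x)\<^sup>2" using R by (intro power_mono) auto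
      then have "R\<^sup>2 * ?u x \<le> (norm x)\<^sup>2 * ?u x" by (intro mult_right_mono) auto
      then show ?thesis using R False by (simp add: field_simps)
    qed simp
  qed
  also have "\<dots> = (LINT x:cball 0 R|lborel. ?u x) + (\<integral>x. (norm x)\<^sup>2 * ?u x \<partial>lborel) / R\<^sup>2"
    unfolding set_lebesgue_integral_def using i1 i2 by (simp add: Bochner_Integration.integral_add)
  also have "(\<integral>x. (norm x)\<^sup>2 * ?u x \<partial>lborel)
      \<le> 8 * T\<^sup>2 * (sobolev_norm (Suc k) f)\<^sup>2 + 4 / a\<^sup>2 * (\<integral>x. exp (a * norm x) * (cmod (f x))\<^sup>2 \<partial>lborel)"
  proof -
    have "(\<integral>y. (norm y)\<^sup>2 * (cmod (f y))\<^sup>2 \<partial>lborel) \<le> (\<integral>y. 2 / a\<^sup>2 * (exp (a * norm y) * (cmod (f y))\<^sup>2) \<partial>lborel)"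
    proof (rule integral_mono)
      show "integrable lborel (\<lambda>y. (norm y)\<^sup>2 * (cmod (f y))\<^sup>2)"
        by (rule compactly_supported_integrable_weighted(1)[OF fc]) (intro continuous_intros)
      show "integrable lborel (\<lambda>y. 2 / a\<^sup>2 * (exp (a * norm y) * (cmod (f y))\<^sup>2))"
        by (intro integrable_mult_right compactly_supported_integrable_weighted(1)[OF fc]) (intro continuous_intros)
      fix y :: "real^'n"
      have "(a * norm y)\<^sup>2 / 2 \<le> exp (a * norm y)"
      proof -
        have "0 \<le> a * norm y" using a by simp
        then show ?thesis using exp_lower_Taylor_quadratic[of "a * norm y"] by linarith
      qed
      then have "(norm y)\<^sup>2 \<le> 2 / a\<^sup>2 * exp (a * norm y)"
        using a by (simp add: field_simps power_mult_distrib)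
      then show "(norm y)\<^sup>2 * (cmod (f y))\<^sup>2 \<le> 2 / a\<^sup>2 * (exp (a * norm y) * (cmod (f y))\<^sup>2)"
        unfolding mult.assoc[symmetric] by (intro mult_right_mono) auto
    qed
    then show ?thesis using schroedinger_moment[OF f T, of k] by simp
  qed
  finally show ?thesis using R by (simp add: divide_right_mono)
qed

section \<open>Propagation of smallness\<close>

text \<open>
  Iterated forward differences with step \<open>v\<close>. Analyticity enters only through their size, so the
  propagation estimates below take place on the real space.
\<close>
primrec fdiff :: "nat \<Rightarrow> 'a::real_vector \<Rightarrow> ('a \<Rightarrow> complex) \<Rightarrow> 'a \<Rightarrow> complex" where
  "fdiff 0 v F x = F x"
| "fdiff (Suc k) v F x = fdiff k v F (x + v) - fdiff k v F x"

text \<open>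
  The shift by \<open>v\<close> is the identity plus the difference operator; this is the binomial theorem for its \<open>u\<close>-th power.
\<close>
lemma newton_forward: "F (x + real u *\<^sub>R v) = (\<Sum>k\<le>u. of_nat (u choose k) * fdiff k v F x)"
proof (induction u arbitrary: x)
  case (Suc u)
  let ?d = "\<lambda>k. fdiff k v F x"
  have "F (x + real (Suc u) *\<^sub>R v) = F ((x + v) + real u *\<^sub>R v)" by (simp add: algebra_simps)
  also have "\<dots> = (\<Sum>k\<le>u. of_nat (u choose k) * (?d (Suc k) + ?d k))"
    unfolding Suc.IH by simp
  also have "\<dots> = (\<Sum>k\<le>u. of_nat (u choose k) * ?d (Suc k)) + (\<Sum>k\<le>u. of_nat (u choose k) * ?d k)"
    by (simp only: distrib_left sum.distrib)
  also have "(\<Sum>k\<le>u. of_nat (u choose k) * ?d k) = ?d 0 + (\<Sum>k\<le>u. of_nat (u choose Suc k) * ?d (Suc k))"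
  proof -
    have "(\<Sum>k\<le>u. of_nat (u choose k) * ?d k) = (\<Sum>k\<le>Suc u. of_nat (u choose k) * ?d k)" by simp
    also have "\<dots> = ?d 0 + (\<Sum>k\<le>u. of_nat (u choose Suc k) * ?d (Suc k))"
      by (subst sum.atMost_Suc_shift) simp
    finally show ?thesis .
  qed
  also have "(\<Sum>k\<le>u. of_nat (u choose k) * ?d (Suc k)) + (?d 0 + (\<Sum>k\<le>u. of_nat (u choose Suc k) * ?d (Suc k)))
      = ?d 0 + (\<Sum>k\<le>u. of_nat (Suc u choose Suc k) * ?d (Suc k))"
    by (simp add: sum.distrib[symmetric] distrib_right)
  also have "\<dots> = (\<Sum>k\<le>Suc u. of_nat (Suc u choose k) * ?d k)"
    by (subst sum.atMost_Suc_shift) simp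
  finally show ?case .
qed simp

lemma fdiff_le_of_nodes:
  assumes "\<And>j. j \<le> k \<Longrightarrow> cmod (F (x + real j *\<^sub>R v)) \<le> m"
  shows "cmod (fdiff k v F x) \<le> 2 ^ k * m"
  using assms
proof (induction k arbitrary: x)
  case 0
  then show ?case using 0[of 0] by simp
next
  case (Suc k)
  have "cmod (fdiff k v F (x + v)) \<le> 2 ^ k * m"
    by (rule Suc.IH) (use Suc.prems[of "Suc _"] in \<open>simp add: algebra_simps\<close>)
  moreover have "cmod (fdiff k v F x) \<le> 2 ^ k * m"
    by (rule Suc.IH) (use Suc.prems in simp)
  ultimately show ?case
    using norm_triangle_ineq4[of "fdiff k v F (x + v)" "fdiff k v F x"] by simp
qed

text \<open>
  A finite-difference form of the Cauchy estimates: for \<open>F\<close> holomorphic and bounded by \<open>M\<close> in the complex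
  neighbourhood of width \<open>\<rho>\<close> those estimates give \<open>k! (|v|/\<rho>)\<^sup>k M\<close>, and \<open>k!\<close> is replaced by \<open>k\<^sup>k\<close>. For \<open>k = 0\<close> the convention
  \<open>0 ^ 0 = 1\<close> makes it the bound \<open>|F| \<le> M\<close>, for \<open>k = 1\<close> it is a Lipschitz bound.
\<close>
definition analytic_type :: "real \<Rightarrow> real \<Rightarrow> ('a::real_normed_vector \<Rightarrow> complex) \<Rightarrow> bool" where
  "analytic_type \<rho> M F \<longleftrightarrow> (\<forall>k v x. cmod (fdiff k v F x) \<le> (real k * norm v / \<rho>) ^ k * M)"

lemma analytic_type_bound: "analytic_type \<rho> M F \<Longrightarrow> cmod (F x) \<le> M"
  unfolding analytic_type_def by (metis fdiff.simps(1) mult_1 power_0)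

lemma analytic_type_lipschitz:
  assumes "analytic_type \<rho> M F" shows "cmod (F y - F x) \<le> norm (y - x) / \<rho> * M"
proof -
  have "cmod (fdiff (Suc 0) (y - x) F x) \<le> (real (Suc 0) * norm (y - x) / \<rho>) ^ Suc 0 * M"
    using assms unfolding analytic_type_def by blast
  then show ?thesis by simp
qed

text \<open>
  Expand \<open>F (c + 2 N v)\<close>, where \<open>v = (x - c) / (2 N)\<close>, by Newton's formula. The differences of order up to \<open>N\<close>
  use only nodes in the small ball and are at most \<open>2\<^sup>N m\<close>; those of higher order are at most
  \<open>(2 h / \<rho>)\<^sup>k M \<le> (1/8) ^ N * M\<close>. The binomial coefficients add up to \<open>4\<^sup>N\<close>.
\<close>
lemma analytic_type_step:
  assumes F: "analytic_type \<rho> M F" and M: "M \<ge> 0" and h: "h > 0" "16 * h \<le> \<rho>"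
    and small: "\<And>z. z \<in> cball c h \<Longrightarrow> cmod (F z) \<le> m" and m: "m \<ge> 0"
    and x: "x \<in> cball c (2 * h)"
  shows "cmod (F x) \<le> 8 ^ N * m + (1 / 2) ^ N * M"
proof (cases "N = 0")
  case True
  then show ?thesis using analytic_type_bound[OF F, of x] m by simp
next
  case False
  define v where "v = (1 / real (2 * N)) *\<^sub>R (x - c)"
  have xv: "x = c + real (2 * N) *\<^sub>R v" using False by (simp add: v_def)
  have nv: "norm v \<le> h / N"
  proof -
    have "norm (x - c) \<le> 2 * h" using x by (simp add: dist_norm norm_minus_commute)
    then show ?thesis unfolding v_def norm_scaleR using False by (simp add: field_simps)
  qed
  have \<rho>: "\<rho> > 0" using h by linarith
  let ?b = "2 ^ N * m + (1 / 8) ^ N * M"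
  have d: "cmod (fdiff k v F c) \<le> ?b" if k: "k \<le> 2 * N" for k
  proof (cases "k \<le> N")
    case True
    have "cmod (fdiff k v F c) \<le> 2 ^ k * m"
    proof (rule fdiff_le_of_nodes, rule small)
      fix j assume "j \<le> k"
      then have "real j * norm v \<le> real N * (h / N)" using True nv h by (intro mult_mono) auto
      then show "c + real j *\<^sub>R v \<in> cball c h" using False by (simp add: dist_norm)
    qed
    also have "\<dots> \<le> 2 ^ N * m" using True m by (intro mult_right_mono power_increasing) auto
    also have "\<dots> \<le> ?b" using M by simp
    finally show ?thesis .
  next
    case kN: False
    have "real k * norm v \<le> real (2 * N) * (h / N)" using k nv h by (intro mult_mono) auto
    then have "real k * norm v / \<rho> \<le> 2 * h / \<rho>" using \<rho> False by (intro divide_right_mono) auto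
    also have "\<dots> \<le> 1 / 8" using h \<rho> by (simp add: field_simps)
    finally have "(real k * norm v / \<rho>) ^ k \<le> (1 / 8) ^ k" using \<rho> by (intro power_mono) auto
    also have "(1 / 8 :: real) ^ k \<le> (1 / 8) ^ N" using kN by (intro power_decreasing) auto
    finally have "(real k * norm v / \<rho>) ^ k * M \<le> (1 / 8) ^ N * M" using M by (intro mult_right_mono)
    moreover have "cmod (fdiff k v F c) \<le> (real k * norm v / \<rho>) ^ k * M"
      using F unfolding analytic_type_def by blast
    moreover have "0 \<le> 2 ^ N * m" using m by simp
    ultimately show ?thesis by linarith
  qed
  have "cmod (F x) = cmod (\<Sum>k\<le>2 * N. of_nat (2 * N choose k) * fdiff k v F c)"
    by (subst xv, subst newton_forward) simp
  also have "\<dots> \<le> (\<Sum>k\<le>2 * N. cmod (of_nat (2 * N choose k) * fdiff k v F c))" by (rule norm_sum)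
  also have "\<dots> \<le> (\<Sum>k\<le>2 * N. real (2 * N choose k) * ?b)"
    using d by (intro sum_mono) (simp add: norm_mult mult_left_mono)
  also have "\<dots> = real (\<Sum>k\<le>2 * N. 2 * N choose k) * ?b"
    by (simp only: sum_distrib_right of_nat_sum)
  also have "\<dots> = 4 ^ N * ?b" by (simp add: choose_row_sum power_mult)
  also have "\<dots> = 8 ^ N * m + (1 / 2) ^ N * M"
    by (simp add: distrib_left mult.assoc[symmetric] power_mult_distrib[symmetric])
  finally show ?thesis .
qed

text \<open>
  Choosing \<open>N\<close> with \<open>2\<^sup>N\<close> of order \<open>1/\<eta>\<close> balances the two terms of the previous estimate. The radius doubles
  while the bound deteriorates from order \<open>\<eta>\<^sup>4\<close> to \<open>\<eta>\<close>; measured by \<open>\<eta>/8\<close> it is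
  exactly a fourth root, which iterates to \<open>(\<eta>/8)^(4^J)\<close>.
\<close>
lemma analytic_type_doubling:
  assumes F: "analytic_type \<rho> M F" and M: "M \<ge> 0" and h: "h > 0" "16 * h \<le> \<rho>"
    and \<eta>: "0 < \<eta>" "\<eta> \<le> 1"
    and small: "\<And>z. z \<in> cball c h \<Longrightarrow> cmod (F z) \<le> 8 * (\<eta> / 8) ^ 4 * M"
    and x: "x \<in> cball c (2 * h)"
  shows "cmod (F x) \<le> \<eta> * M"
proof -
  define N where "N = (LEAST N. 2 / \<eta> \<le> 2 ^ N)"
  have ex: "\<exists>N. 2 / \<eta> \<le> 2 ^ N" using real_arch_pow[of 2 "2 / \<eta>"] less_imp_le by auto
  have N: "2 / \<eta> \<le> 2 ^ N" unfolding N_def using ex by (rule LeastI_ex)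
  have "2 ^ N \<le> 4 / \<eta>"
  proof (cases N)
    case 0
    then show ?thesis using \<eta> by (simp add: field_simps)
  next
    case (Suc N')
    then have "\<not> 2 / \<eta> \<le> 2 ^ N'" unfolding N_def by (intro not_less_Least) simp
    then show ?thesis using Suc by simp
  qed
  then have "(2 ^ N) ^ 3 \<le> (4 / \<eta>) ^ 3" by (intro power_mono) auto
  then have "8 ^ N \<le> (4 / \<eta>) ^ 3" by (simp add: power_mult[symmetric] mult.commute[of N]) (simp add: power_mult)
  then have "8 ^ N * (8 * (\<eta> / 8) ^ 4) \<le> (4 / \<eta>) ^ 3 * (8 * (\<eta> / 8) ^ 4)"
    using \<eta> by (intro mult_right_mono) auto
  also have "\<dots> = \<eta> / 8" using \<eta> by (simp add: field_simps power_numeral_reduce)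
  finally have 1: "8 ^ N * (8 * (\<eta> / 8) ^ 4) \<le> \<eta> / 8" .
  have 2: "(1 / 2) ^ N \<le> \<eta> / 2" using N \<eta> by (simp add: power_one_over field_simps)
  have "cmod (F x) \<le> 8 ^ N * (8 * (\<eta> / 8) ^ 4 * M) + (1 / 2) ^ N * M"
    by (rule analytic_type_step[OF F M h small _ x]) (use M in auto)
  also have "\<dots> = (8 ^ N * (8 * (\<eta> / 8) ^ 4) + (1 / 2) ^ N) * M" by (simp add: algebra_simps)
  also have "\<dots> \<le> \<eta> * M" using 1 2 \<eta> M by (intro mult_right_mono) auto
  finally show ?thesis .
qed

text \<open>
  One induction step enlarges the ball by \<open>h\<close>: a point at distance between \<open>(J+1) h\<close> and \<open>(J+2) h\<close> from \<open>x\<^sub>0\<close> lies in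
  the doubling of a ball of radius \<open>h\<close> that is contained in the ball already reached. The exponents \<open>4^J\<close> record the
  loss of a fourth root in each step.
\<close>
lemma analytic_type_propagation:
  fixes F :: "'a::real_normed_vector \<Rightarrow> complex"
  assumes F: "analytic_type \<rho> M F" and M: "M \<ge> 0" and h: "h > 0" "16 * h \<le> \<rho>"
    and \<eta>: "0 < \<eta>" "\<eta> \<le> 1"
    and small: "\<And>z. z \<in> cball x0 h \<Longrightarrow> cmod (F z) \<le> (\<eta> / 8) ^ (4 ^ J) * M"
    and x: "x \<in> cball x0 (real (Suc J) * h)"
  shows "cmod (F x) \<le> \<eta> * M"
  using \<eta> small x
proof (induction J arbitrary: \<eta> x)
  case 0
  have "cmod (F x) \<le> \<eta> / 8 * M" using 0 by simp
  also have "\<dots> \<le> \<eta> * M" using 0 M by (intro mult_right_mono) auto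
  finally show ?case .
next
  case (Suc J)
  define \<eta>' where "\<eta>' = 8 * (\<eta> / 8) ^ 4"
  have "(\<eta> / 8) ^ 4 \<le> (\<eta> / 8) ^ 1" using Suc.prems by (intro power_decreasing) auto
  then have \<eta>': "0 < \<eta>'" "\<eta>' \<le> \<eta>" using Suc.prems by (auto simp: \<eta>'_def)
  have pw: "(\<eta>' / 8) ^ (4 ^ J) = (\<eta> / 8) ^ (4 ^ Suc J)"
    by (simp add: \<eta>'_def power_mult[symmetric])
  have IH: "cmod (F z) \<le> \<eta>' * M" if "z \<in> cball x0 (real (Suc J) * h)" for z
    by (rule Suc.IH[of \<eta>']) (use \<eta>' Suc.prems that pw in auto)
  show ?case
  proof (cases "dist x0 x \<le> real (Suc J) * h")
    case True
    then have "cmod (F x) \<le> \<eta>' * M" using IH by simp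
    also have "\<dots> \<le> \<eta> * M" using \<eta>' M by (intro mult_right_mono) auto
    finally show ?thesis .
  next
    case False
    have far: "norm (x - x0) > real (Suc J) * h" using False by (simp add: dist_norm norm_minus_commute)
    have pos: "0 < norm (x - x0)" using far h by (smt (verit) mult_nonneg_nonneg of_nat_0_le_iff)
    \<comment> \<open>The centre at distance \<open>J h\<close> from \<open>x0\<close> on the segment towards \<open>x\<close>.\<close>
    define c where "c = x0 + (real J * h / norm (x - x0)) *\<^sub>R (x - x0)"
    have c1: "dist x0 c = real J * h" using pos h by (simp add: c_def dist_norm)
    have "x - c = (1 - real J * h / norm (x - x0)) *\<^sub>R (x - x0)"
      by (simp add: c_def algebra_simps)
    moreover have "real J * h / norm (x - x0) \<le> 1" using far pos h by (simp add: field_simps)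
    ultimately have "norm (x - c) = (1 - real J * h / norm (x - x0)) * norm (x - x0)"
      by simp
    also have "\<dots> = norm (x - x0) - real J * h" using pos by (simp add: field_simps)
    also have "\<dots> \<le> 2 * h" using Suc.prems(4) by (simp add: dist_norm norm_minus_commute algebra_simps)
    finally have c2: "x \<in> cball c (2 * h)" by (simp add: dist_norm norm_minus_commute)
    show ?thesis
    proof (rule analytic_type_doubling[OF F M h Suc.prems(1,2) _ c2])
      fix z assume "z \<in> cball c h"
      then have "dist x0 z \<le> real J * h + h" using c1 dist_triangle[of x0 z c] by (simp add: dist_commute)
      then show "cmod (F z) \<le> 8 * (\<eta> / 8) ^ 4 * M"
        using IH[of z] by (simp add: \<eta>'_def algebra_simps)
    qed
  qed
qed

lemma cmod_cis_minus_1_le: "cmod (cis t - 1) \<le> \<bar>t\<bar>"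
proof (rule power2_le_imp_le)
  have "(cmod (cis t - 1))\<^sup>2 = (cos t - 1)\<^sup>2 + (sin t)\<^sup>2" by (simp add: cmod_power2)
  also have "\<dots> = 2 * (1 - cos t)"
    using sin_cos_squared_add[of t] by (simp add: power2_diff algebra_simps)
  also have "\<dots> = (2 * sin (t / 2))\<^sup>2"
    using cos_double_sin[of "t / 2"] by (simp add: power_mult_distrib)
  also have "\<dots> \<le> t\<^sup>2" using abs_sin_x_le_abs_x[of "t / 2"] by (subst abs_le_square_iff[symmetric]) simp
  finally show "(cmod (cis t - 1))\<^sup>2 \<le> \<bar>t\<bar>\<^sup>2" by simp
qed simp

text \<open>
  Take the \<open>k\<close>-th power of \<open>s/k \<le> exp (s/k)\<close>.
\<close>
lemma power_le_exp:
  assumes "s \<ge> (0::real)" shows "s ^ k \<le> real k ^ k * exp s"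
proof (cases "k = 0")
  case False
  have "(s / k) ^ k \<le> exp (s / k) ^ k"
  proof (rule power_mono)
    show "s / k \<le> exp (s / k)" using exp_ge_add_one_self[of "s / k"] by linarith
  qed (use assms in simp)
  also have "\<dots> = exp s" using False by (simp add: exp_of_nat_mult[symmetric])
  finally show ?thesis using False by (simp add: power_divide field_simps)
qed (use assms in simp)

text \<open>
  A forward difference of a Fourier integral multiplies the integrand by \<open>cis (- (y \<bullet> v)) - 1\<close>.
\<close>
lemma fdiff_fourier_integral:
  fixes g :: "'a::euclidean_space \<Rightarrow> complex"
  assumes g: "g \<in> compactly_supported"
  shows "fdiff k v (fourier_integral g) x = (\<integral>y. cis (- (y \<bullet> x)) * (cis (- (y \<bullet> v)) - 1) ^ k * g y \<partial>lborel)"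
proof (induction k arbitrary: x)
  case 0
  show ?case by (simp add: fourier_integral_def)
next
  case (Suc k)
  have i: "integrable lborel (\<lambda>y. cis (- (y \<bullet> x)) * (cis (- (y \<bullet> v)) - 1) ^ k * g y)" for x
    by (intro compactly_supported_integrable compactly_supported_mult g) (intro continuous_intros continuous_on_cis)
  have "fdiff (Suc k) v (fourier_integral g) x
     = (\<integral>y. cis (- (y \<bullet> (x + v))) * (cis (- (y \<bullet> v)) - 1) ^ k * g y - cis (- (y \<bullet> x)) * (cis (- (y \<bullet> v)) - 1) ^ k * g y \<partial>lborel)"
    unfolding fdiff.simps Suc.IH by (rule Bochner_Integration.integral_diff[symmetric]) (rule i)+
  also have "\<dots> = (\<integral>y. cis (- (y \<bullet> x)) * (cis (- (y \<bullet> v)) - 1) ^ Suc k * g y \<partial>lborel)"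
  proof (intro Bochner_Integration.integral_cong refl)
    fix y
    have "cis (- (y \<bullet> (x + v))) = cis (- (y \<bullet> x)) * cis (- (y \<bullet> v))"
      by (simp add: cis_mult inner_add_right)
    then show "cis (- (y \<bullet> (x + v))) * (cis (- (y \<bullet> v)) - 1) ^ k * g y - cis (- (y \<bullet> x)) * (cis (- (y \<bullet> v)) - 1) ^ k * g y
       = cis (- (y \<bullet> x)) * (cis (- (y \<bullet> v)) - 1) ^ Suc k * g y"
      by (simp add: algebra_simps)
  qed
  finally show ?case .
qed

text \<open>
  The weight pays for the factor \<open>|y|\<^sup>k\<close> that comes from the \<open>k\<close>-th difference: \<open>(b |y|)\<^sup>k \<le> k\<^sup>k exp (b |y|)\<close>.
\<close>
lemma fourier_integral_analytic_type:
  fixes g :: "'a::euclidean_space \<Rightarrow> complex"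
  assumes g: "g \<in> compactly_supported" and b: "b > 0"
  shows "analytic_type b (\<integral>y. exp (b * norm y) * cmod (g y) \<partial>lborel) (fourier_integral g)"
  unfolding analytic_type_def
proof (intro allI)
  fix k and v x :: 'a
  have "cmod (fdiff k v (fourier_integral g) x) \<le> (\<integral>y. (real k * norm v / b) ^ k * (exp (b * norm y) * cmod (g y)) \<partial>lborel)"
    unfolding fdiff_fourier_integral[OF g]
  proof (rule Bochner_Integration.integral_norm_bound_integral)
    show "integrable lborel (\<lambda>y. cis (- (y \<bullet> x)) * (cis (- (y \<bullet> v)) - 1) ^ k * g y)"
      by (intro compactly_supported_integrable compactly_supported_mult g) (intro continuous_intros continuous_on_cis)
    show "integrable lborel (\<lambda>y. (real k * norm v / b) ^ k * (exp (b * norm y) * cmod (g y)))"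
      by (intro integrable_mult_right compactly_supported_integrable_weighted(2) g continuous_intros)
    fix y :: 'a
    have "\<bar>y \<bullet> v\<bar> \<le> norm y * norm v" by (rule Cauchy_Schwarz_ineq2)
    then have "cmod (cis (- (y \<bullet> v)) - 1) \<le> norm y * norm v"
      using cmod_cis_minus_1_le[of "- (y \<bullet> v)"] by simp
    then have "cmod (cis (- (y \<bullet> v)) - 1) ^ k \<le> (norm y * norm v) ^ k" by (intro power_mono) auto
    also have "\<dots> = (norm v / b) ^ k * (b * norm y) ^ k"
      using b by (simp add: power_mult_distrib[symmetric] mult.commute)
    also have "\<dots> \<le> (norm v / b) ^ k * (real k ^ k * exp (b * norm y))"
      using b by (intro mult_left_mono power_le_exp) auto
    also have "\<dots> = (real k * norm v / b) ^ k * exp (b * norm y)"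
      by (simp add: power_mult_distrib power_divide)
    finally have "cmod (cis (- (y \<bullet> v)) - 1) ^ k * cmod (g y) \<le> (real k * norm v / b) ^ k * exp (b * norm y) * cmod (g y)"
      by (rule mult_right_mono) simp
    then show "cmod (cis (- (y \<bullet> x)) * (cis (- (y \<bullet> v)) - 1) ^ k * g y) \<le> (real k * norm v / b) ^ k * (exp (b * norm y) * cmod (g y))"
      by (simp add: norm_mult norm_power mult.assoc)
  qed
  then show "cmod (fdiff k v (fourier_integral g) x) \<le> (real k * norm v / b) ^ k * (\<integral>y. exp (b * norm y) * cmod (g y) \<partial>lborel)"
    by simp
qed

lemma fdiff_scale: "fdiff k v (\<lambda>x. c * F (s *\<^sub>R x)) x = c * fdiff k (s *\<^sub>R v) F (s *\<^sub>R x)"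
  by (induction k arbitrary: x) (simp_all add: algebra_simps)

lemma analytic_type_scale:
  assumes F: "analytic_type b M F" and c: "c \<ge> 0" and s: "s > 0"
  shows "analytic_type (b / s) (c * M) (\<lambda>x. complex_of_real c * F (s *\<^sub>R x))"
  unfolding analytic_type_def fdiff_scale
proof (intro allI)
  fix k v x
  have "cmod (fdiff k (s *\<^sub>R v) F (s *\<^sub>R x)) \<le> (real k * norm (s *\<^sub>R v) / b) ^ k * M"
    using F unfolding analytic_type_def by blast
  then have "c * cmod (fdiff k (s *\<^sub>R v) F (s *\<^sub>R x)) \<le> c * ((real k * norm (s *\<^sub>R v) / b) ^ k * M)"
    using c by (rule mult_left_mono)
  then show "cmod (complex_of_real c * fdiff k (s *\<^sub>R v) F (s *\<^sub>R x)) \<le> (real k * norm v / (b / s)) ^ k * (c * M)"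
    using c s by (simp add: norm_mult mult_ac)
qed

section \<open>The dichotomy for the evolution\<close>

text \<open>
  Expand \<open>\<integral> (f - t g)\<^sup>2 \<ge> 0\<close> at \<open>t = \<integral> f g / G\<close>. A positive upper bound \<open>G\<close> in place of \<open>\<integral> g\<^sup>2\<close> makes the division
  legitimate.
\<close>
lemma cauchy_schwarz_integral:
  fixes f g :: "'a \<Rightarrow> real"
  assumes f: "integrable M (\<lambda>x. (f x)\<^sup>2)" and fg: "integrable M (\<lambda>x. f x * g x)"
    and g: "integrable M (\<lambda>x. (g x)\<^sup>2)" and G: "(\<integral>x. (g x)\<^sup>2 \<partial>M) \<le> G" "G > 0"
  shows "(\<integral>x. f x * g x \<partial>M)\<^sup>2 \<le> G * (\<integral>x. (f x)\<^sup>2 \<partial>M)"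
proof -
  let ?P = "\<integral>x. f x * g x \<partial>M" and ?F = "\<integral>x. (f x)\<^sup>2 \<partial>M"
  define t where "t = ?P / G"
  have "0 \<le> (\<integral>x. (f x - t * g x)\<^sup>2 \<partial>M)" by (intro integral_nonneg_AE AE_I2) simp
  also have "\<dots> = (\<integral>x. (f x)\<^sup>2 - 2 * t * (f x * g x) + t\<^sup>2 * (g x)\<^sup>2 \<partial>M)"
    by (simp add: power2_diff power_mult_distrib algebra_simps)
  also have "\<dots> = ?F - 2 * t * ?P + t\<^sup>2 * (\<integral>x. (g x)\<^sup>2 \<partial>M)"
    using f fg g by (simp add: mult.assoc)
  also have "\<dots> \<le> ?F - 2 * t * ?P + t\<^sup>2 * G" using G by (simp add: mult_left_mono)
  also have "\<dots> = ?F - ?P\<^sup>2 / G" using G by (simp add: t_def power2_eq_square field_simps)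
  finally show ?thesis using G by (simp add: field_simps)
qed

lemma integrable_exp_neg_norm: "integrable lborel (\<lambda>y::'a::euclidean_space. exp (- norm y))"
proof (rule integrable_of_decay)
  fix y :: 'a
  let ?n = "real DIM('a)"
  define s where "s = norm y / ?n"
  have n: "?n > 0" by simp
  have s: "s \<ge> 0" "norm y = ?n * s" using n by (auto simp: s_def)
  have "s\<^sup>2 / 2 \<le> exp s" using exp_lower_Taylor_quadratic[OF s(1)] s(1) by linarith
  then have "?n\<^sup>2 * s\<^sup>2 \<le> ?n\<^sup>2 * (2 * exp s)" by (intro mult_left_mono) auto
  moreover have "1 \<le> exp s" using s by simp
  ultimately have "1 + (norm y)\<^sup>2 \<le> (1 + 2 * ?n\<^sup>2) * exp s"
  proof -
    have "(1 + 2 * ?n\<^sup>2) * exp s = exp s + ?n\<^sup>2 * (2 * exp s)" by (simp add: algebra_simps)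
    with \<open>?n\<^sup>2 * s\<^sup>2 \<le> ?n\<^sup>2 * (2 * exp s)\<close> \<open>1 \<le> exp s\<close> show ?thesis
      unfolding s(2) power_mult_distrib by linarith
  qed
  then have "(1 + (norm y)\<^sup>2) ^ DIM('a) \<le> ((1 + 2 * ?n\<^sup>2) * exp s) ^ DIM('a)"
    by (intro power_mono) auto
  also have "\<dots> = (1 + 2 * ?n\<^sup>2) ^ DIM('a) * exp (norm y)"
    unfolding power_mult_distrib s(2) by (simp add: exp_of_nat_mult[symmetric])
  finally show "(1 + (norm y)\<^sup>2) ^ DIM('a) * norm (exp (- norm y)) \<le> (1 + 2 * ?n\<^sup>2) ^ DIM('a)"
    by (simp add: exp_minus field_simps)
qed measurable

text \<open>
  Cauchy-Schwarz for \<open>exp (a |y| / 2) |f|\<close> and \<open>exp (- a |y| / 4)\<close>; a dilation extracts the power of \<open>a\<close> from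
  the integral of \<open>exp (- a |y| / 2)\<close>.
\<close>
lemma weighted_L1_le:
  fixes f :: "'a::euclidean_space \<Rightarrow> complex"
  assumes f: "f \<in> compactly_supported" and a: "a > 0"
    and E: "(\<integral>y. exp (- norm y) \<partial>(lborel :: 'a measure)) \<le> E" "E > 0"
  shows "(\<integral>y. exp (a / 4 * norm y) * cmod (f y) \<partial>lborel)\<^sup>2
    \<le> (2 / a) ^ DIM('a) * E * (\<integral>y. exp (a * norm y) * (cmod (f y))\<^sup>2 \<partial>lborel)"
proof -
  let ?F = "\<lambda>y. exp (a / 2 * norm y) * cmod (f y)" and ?G = "\<lambda>y::'a. exp (- (a / 4) * norm y)"
  have FG: "?F y * ?G y = exp (a / 4 * norm y) * cmod (f y)" for y
  proof -
    have "exp (a / 2 * norm y) * exp (- (a / 4) * norm y) = exp (a / 4 * norm y)"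
      unfolding exp_add[symmetric] by (simp add: algebra_simps)
    then show ?thesis by (metis mult.assoc mult.commute)
  qed
  have FF: "(?F y)\<^sup>2 = exp (a * norm y) * (cmod (f y))\<^sup>2" for y
    by (simp add: power_mult_distrib exp_double[symmetric])
  have GG: "(?G y)\<^sup>2 = exp (- norm (0 + (a / 2) *\<^sub>R y))" for y
    using a by (simp add: exp_double[symmetric])
  have a2: "a / 2 \<noteq> 0" using a by simp
  have iG: "integrable lborel (\<lambda>y. (?G y)\<^sup>2)"
    unfolding GG using lborel_integrable_affine_iff[OF _ a2, of "\<lambda>y::'a. exp (- norm y)" 0] integrable_exp_neg_norm[where 'a='a]
    by simp
  have "(\<integral>y. exp (- norm y) \<partial>(lborel :: 'a measure)) = (a / 2) ^ DIM('a) * (\<integral>y. (?G y)\<^sup>2 \<partial>lborel)"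
    unfolding GG using lborel_integral_affine[OF _ a2, of "\<lambda>y::'a. exp (- norm y)" 0] a by simp
  then have "(a / 2) ^ DIM('a) * (\<integral>y. (?G y)\<^sup>2 \<partial>lborel) \<le> E" using E by simp
  then have "(\<integral>y. (?G y)\<^sup>2 \<partial>lborel) \<le> E / (a / 2) ^ DIM('a)"
    using a by (subst pos_le_divide_eq) (auto simp: mult.commute)
  also have "E / (a / 2) ^ DIM('a) = (2 / a) ^ DIM('a) * E" using a by (simp add: power_divide)
  finally have "(\<integral>y. (?G y)\<^sup>2 \<partial>lborel) \<le> (2 / a) ^ DIM('a) * E" .
  then have "(\<integral>y. ?F y * ?G y \<partial>lborel)\<^sup>2 \<le> (2 / a) ^ DIM('a) * E * (\<integral>y. (?F y)\<^sup>2 \<partial>lborel)"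
  proof (intro cauchy_schwarz_integral iG)
    show "integrable lborel (\<lambda>y. (?F y)\<^sup>2)" unfolding FF
      by (intro compactly_supported_integrable_weighted(1) f continuous_intros)
    show "integrable lborel (\<lambda>y. ?F y * ?G y)" unfolding FG
      by (intro compactly_supported_integrable_weighted(2) f continuous_intros)
    show "0 < (2 / a) ^ DIM('a) * E" using a E by simp
  qed
  then show ?thesis unfolding FG FF .
qed

lemma analytic_type_mono:
  assumes "analytic_type \<rho> M F" "M \<le> M'" "\<rho> > 0" shows "analytic_type \<rho> M' F"
  unfolding analytic_type_def
proof (intro allI)
  fix k v x
  have "cmod (fdiff k v F x) \<le> (real k * norm v / \<rho>) ^ k * M"
    using assms(1) unfolding analytic_type_def by blast
  also have "\<dots> \<le> (real k * norm v / \<rho>) ^ k * M'"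
    using assms(2,3) by (intro mult_left_mono) auto
  finally show "cmod (fdiff k v F x) \<le> (real k * norm v / \<rho>) ^ k * M'" .
qed

text \<open>
  By the Lipschitz bound \<open>M/\<rho>\<close>, a value above \<open>\<mu> M\<close> persists as \<open>|F| \<ge> \<mu> M / 2\<close> on a ball of radius \<open>\<mu> h \<le> \<mu> \<rho> / 2\<close>.
\<close>
lemma analytic_type_concentration:
  fixes F :: "'a::euclidean_space \<Rightarrow> complex"
  assumes F: "analytic_type \<rho> M F" and M: "M \<ge> 0" and h: "h > 0" "16 * h \<le> \<rho>" "2 * h \<le> r"
    and \<mu>: "0 < \<mu>" "\<mu> \<le> 1" and y: "y \<in> cball x0 h" "cmod (F y) > \<mu> * M"
    and int: "integrable lborel (\<lambda>x. (cmod (F x))\<^sup>2)"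
  shows "(\<mu> * M / 2)\<^sup>2 * (unit_ball_vol (real DIM('a)) * (\<mu> * h) ^ DIM('a))
    \<le> (LINT x:cball x0 r|lborel. (cmod (F x))\<^sup>2)"
proof -
  have mh: "0 \<le> \<mu> * h" "\<mu> * h \<le> h" using \<mu> h by (auto simp: mult_le_cancel_right1)
  have \<rho>: "\<rho> > 0" using h by linarith
  have "(\<mu> * M / 2)\<^sup>2 * (unit_ball_vol (real DIM('a)) * (\<mu> * h) ^ DIM('a)) = (\<integral>x. indicator (ball y (\<mu> * h)) x * (\<mu> * M / 2)\<^sup>2 \<partial>lborel)"
    using content_ball[OF mh(1), of y] by simp
  also have "\<dots> \<le> (\<integral>x. indicator (cball x0 r) x *\<^sub>R (cmod (F x))\<^sup>2 \<partial>lborel)"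
  proof (rule integral_mono)
    show "integrable lborel (\<lambda>x. indicator (ball y (\<mu> * h)) x * (\<mu> * M / 2)\<^sup>2)"
      by (intro integrable_mult_left integrable_real_indicator) (auto simp: emeasure_ball[OF mh(1)])
    show "integrable lborel (\<lambda>x. indicator (cball x0 r) x *\<^sub>R (cmod (F x))\<^sup>2)"
      by (rule integrable_mult_indicator[OF _ int]) simp
    fix x
    show "indicator (ball y (\<mu> * h)) x * (\<mu> * M / 2)\<^sup>2 \<le> indicator (cball x0 r) x *\<^sub>R (cmod (F x))\<^sup>2"
    proof (cases "x \<in> ball y (\<mu> * h)")
      case True
      then have d: "dist y x \<le> \<mu> * h" by simp
      have "dist x0 y \<le> h" using y(1) by simp
      then have "dist x0 x \<le> r" using d mh(2) h(3) dist_triangle[of x0 x y] by linarith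
      have "cmod (F y - F x) \<le> norm (y - x) / \<rho> * M" by (rule analytic_type_lipschitz[OF F])
      also have "\<dots> \<le> (\<mu> / 2) * M"
      proof (intro mult_right_mono M)
        have "norm (y - x) \<le> \<mu> * (\<rho> / 2)"
        proof -
          have "\<mu> * h \<le> \<mu> * (\<rho> / 2)" using h \<mu> by (intro mult_left_mono) auto
          with d show ?thesis unfolding dist_norm by linarith
        qed
        then show "norm (y - x) / \<rho> \<le> \<mu> / 2" using \<rho> by (simp add: field_simps)
      qed
      finally have "\<mu> * M / 2 \<le> cmod (F x)"
        using y(2) norm_triangle_ineq2[of "F y" "F x"] by simp
      then have "(\<mu> * M / 2)\<^sup>2 \<le> (cmod (F x))\<^sup>2" using \<mu> M by (intro power_mono) auto
      with \<open>dist x0 x \<le> r\<close> True show ?thesis by simp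
    qed simp
  qed
  finally show ?thesis by (simp add: set_lebesgue_integral_def)
qed

lemma set_integral_square_le:
  fixes F :: "'a::euclidean_space \<Rightarrow> complex"
  assumes int: "integrable lborel (\<lambda>x. (cmod (F x))\<^sup>2)" and R: "R \<ge> 0"
    and K: "\<And>x. x \<in> cball z R \<Longrightarrow> cmod (F x) \<le> K"
  shows "(LINT x:cball z R|lborel. (cmod (F x))\<^sup>2) \<le> K\<^sup>2 * (unit_ball_vol (real DIM('a)) * R ^ DIM('a))"
proof -
  have "(\<integral>x. indicator (cball z R) x *\<^sub>R (cmod (F x))\<^sup>2 \<partial>lborel) \<le> (\<integral>x. indicator (cball z R) x * K\<^sup>2 \<partial>lborel)"
  proof (rule integral_mono)
    show "integrable lborel (\<lambda>x. indicator (cball z R) x *\<^sub>R (cmod (F x))\<^sup>2)"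
      by (rule integrable_mult_indicator[OF _ int]) simp
    show "integrable lborel (\<lambda>x::'a. indicator (cball z R) x * K\<^sup>2)"
      by (intro integrable_mult_left integrable_real_indicator) (auto simp: emeasure_cball[OF R])
    show "indicator (cball z R) x *\<^sub>R (cmod (F x))\<^sup>2 \<le> indicator (cball z R) x * K\<^sup>2" for x
      using K[of x] by (auto simp: indicator_def intro!: power_mono)
  qed
  also have "\<dots> = K\<^sup>2 * (unit_ball_vol (real DIM('a)) * R ^ DIM('a))"
    using content_cball[OF R, of z] by simp
  finally show ?thesis by (simp add: set_lebesgue_integral_def)
qed

text \<open>
  The step \<open>h = a T / 32\<close> satisfies \<open>16 h = \<rho>\<close> for \<open>\<rho> = a T / 2\<close>, and \<open>2 h \<le> r\<close>. The bound \<open>M\<close> is normalised so that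
  \<open>M\<^sup>2 h\<^sup>n\<close> is a dimensional constant times \<open>A\<close>, which removes \<open>a\<close> and \<open>T\<close> from the second alternative.
\<close>
lemma schroedinger_dichotomy:
  fixes f :: "real^'n \<Rightarrow> complex" and x0 :: "real^'n"
  assumes f: "f \<in> test_functions" and T: "T > 0" and a: "a > 0" and r: "a * T \<le> r" and R: "R > 0"
    and \<eta>: "0 < \<eta>" "\<eta> \<le> 1" and J: "norm x0 + R \<le> real (Suc J) * (a * T / 32)"
    and E: "(\<integral>y. exp (- norm y) \<partial>(lborel :: (real^'n) measure)) \<le> E" "E > 0"
  defines "A \<equiv> \<integral>x. exp (a * norm x) * (cmod (f x))\<^sup>2 \<partial>lborel"
  shows "(\<integral>x. (cmod (f x))\<^sup>2 \<partial>lborel) \<le>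
        \<eta>\<^sup>2 * E * unit_ball_vol (real CARD('n)) * (R / (2 * pi * (a * T))) ^ CARD('n) * A
        + (8 * T\<^sup>2 * (sobolev_norm (Suc k) f)\<^sup>2 + 4 / a\<^sup>2 * A) / R\<^sup>2
    \<or> A \<le> 4 * (64 * pi) ^ CARD('n) / (E * unit_ball_vol (real CARD('n))) * (8 / \<eta>) ^ (4 ^ J * (CARD('n) + 2))
        * (LINT x:cball x0 r|lborel. (cmod (schroedinger_group T f x))\<^sup>2)"
proof -
  let ?n = "CARD('n)"
  let ?w = "unit_ball_vol (real ?n)"
  let ?c = "(1 / sqrt (4 * pi * T)) ^ ?n"
  define d where "d = a * T"
  define h where "h = d / 32"
  define \<mu> where "\<mu> = (\<eta> / 8) ^ (4 ^ J)"
  have d: "d > 0" and h: "h > 0" "16 * h \<le> d / 2" "2 * h \<le> r"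
  proof -
    show "d > 0" using a T by (simp add: d_def)
    then show "h > 0" "16 * h \<le> d / 2" "2 * h \<le> r" using r by (auto simp: h_def d_def[symmetric])
  qed
  have \<mu>: "0 < \<mu>" "\<mu> \<le> 1" using \<eta> by (auto simp: \<mu>_def intro!: power_le_one)
  have w: "?w > 0" by simp
  note fc = C1_compactD(1)[OF test_function_C1_compact[OF f]]
  note gc = C1_compactD(1)[OF chirp_C1_compact[OF test_function_C1_compact[OF f], of T]]
  have A0: "A \<ge> 0" unfolding A_def by (intro integral_nonneg_AE AE_I2) simp
  define M where "M = sqrt (E * (1 / (2 * pi * d)) ^ ?n * A)"
  have M: "M \<ge> 0" "M\<^sup>2 = E * (1 / (2 * pi * d)) ^ ?n * A"
    using E A0 d by (auto simp: M_def)
  define F where "F x = complex_of_real ?c * fourier_integral (chirp T f) ((1 / (2 * T)) *\<^sub>R x)" for x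
  have uF: "cmod (schroedinger_group T f x) = cmod (F x)" for x
    unfolding cmod_schroedinger_group[OF f T] F_def using T
    by (simp add: norm_mult norm_divide norm_power inverse_eq_divide)
  have F: "analytic_type (d / 2) M F"
  proof -
    let ?I = "\<integral>y. exp (a / 4 * norm y) * cmod (f y) \<partial>lborel"
    have "analytic_type (a / 4) ?I (fourier_integral (chirp T f))"
      using fourier_integral_analytic_type[OF gc, of "a / 4"] a by simp
    then have "analytic_type (a / 4 / (1 / (2 * T))) (?c * ?I) F"
      unfolding F_def[abs_def] by (rule analytic_type_scale) (use T in auto)
    moreover have "?c * ?I \<le> M"
    proof (rule power2_le_imp_le)
      have "(1 / sqrt (4 * pi * T))\<^sup>2 = 1 / (4 * pi * T)" using T by (simp add: power_divide)
      then have c2: "?c\<^sup>2 = (1 / (4 * pi * T)) ^ ?n" by (metis power_mult mult.commute)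
      have "(?c * ?I)\<^sup>2 \<le> (1 / (4 * pi * T)) ^ ?n * ((2 / a) ^ ?n * E * A)"
        unfolding power_mult_distrib[of ?c] c2 A_def
        using weighted_L1_le[OF fc a E] T by (intro mult_left_mono) auto
      also have "\<dots> = E * ((1 / (4 * pi * T)) * (2 / a)) ^ ?n * A"
        unfolding power_mult_distrib by simp
      also have "(1 / (4 * pi * T)) * (2 / a) = 1 / (2 * pi * d)"
        using a T by (simp add: d_def field_simps)
      finally show "(?c * ?I)\<^sup>2 \<le> M\<^sup>2" unfolding M(2) .
    qed (rule M)
    moreover have "a / 4 / (1 / (2 * T)) = d / 2" by (simp add: d_def)
    ultimately show ?thesis using d by (auto intro: analytic_type_mono)
  qed
  have int: "integrable lborel (\<lambda>x. (cmod (F x))\<^sup>2)"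
    using schroedinger_mass_integrable[OF f T] unfolding uF .
  show ?thesis
  proof (cases "\<forall>z\<in>cball x0 h. cmod (F z) \<le> \<mu> * M")
    case True
    have "(LINT x:cball 0 R|lborel. (cmod (F x))\<^sup>2) \<le> (\<eta> * M)\<^sup>2 * (unit_ball_vol (real DIM(real^'n)) * R ^ DIM(real^'n))"
    proof (rule set_integral_square_le[OF int])
      fix x :: "real^'n" assume "x \<in> cball 0 R"
      then have "dist x0 x \<le> norm x0 + R"
        using norm_triangle_ineq4[of x0 x] by (simp add: dist_norm)
      then have x: "x \<in> cball x0 (real (Suc J) * h)" using J by (simp add: h_def d_def)
      show "cmod (F x) \<le> \<eta> * M"
        by (rule analytic_type_propagation[OF F M(1) h(1,2) \<eta> _ x]) (use True in \<open>simp add: \<mu>_def\<close>)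
    qed (use R in simp)
    also have "\<dots> = \<eta>\<^sup>2 * E * ?w * (R / (2 * pi * d)) ^ ?n * A"
      unfolding power_mult_distrib[of \<eta>] M(2) by (simp add: power_divide)
    finally show ?thesis
      using schroedinger_tail[OF f T a R, of k] unfolding uF A_def[symmetric] d_def by linarith
  next
    case False
    then obtain y where y: "y \<in> cball x0 h" "cmod (F y) > \<mu> * M" by force
    have "(\<mu> * M / 2)\<^sup>2 * (?w * (\<mu> * h) ^ ?n) \<le> (LINT x:cball x0 r|lborel. (cmod (F x))\<^sup>2)"
      using analytic_type_concentration[OF F M(1) h \<mu> y int] by simp
    moreover have "(\<mu> * M / 2)\<^sup>2 * (?w * (\<mu> * h) ^ ?n) = E * ?w / (4 * (64 * pi) ^ ?n) * \<mu> ^ (?n + 2) * A"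
    proof -
      have "(1 / (2 * pi * d)) ^ ?n * h ^ ?n = (1 / (64 * pi)) ^ ?n"
        unfolding power_mult_distrib[symmetric] h_def using d by simp
      then have hM: "M\<^sup>2 * h ^ ?n = E * (1 / (64 * pi)) ^ ?n * A"
        unfolding M(2) by (metis mult.assoc mult.commute)
      have "(\<mu> * M / 2)\<^sup>2 * (?w * (\<mu> * h) ^ ?n) = \<mu> ^ (?n + 2) * ?w / 4 * (M\<^sup>2 * h ^ ?n)"
        by (simp add: power_mult_distrib power_divide power_add power2_eq_square)
      then show ?thesis unfolding hM by (simp add: power_divide field_simps)
    qed
    ultimately have le: "E * ?w / (4 * (64 * pi) ^ ?n) * \<mu> ^ (?n + 2) * A \<le> (LINT x:cball x0 r|lborel. (cmod (F x))\<^sup>2)"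
      by simp
    have "1 / \<mu> = (8 / \<eta>) ^ (4 ^ J)" by (simp add: \<mu>_def power_divide)
    then have inv: "(8 / \<eta>) ^ (4 ^ J * (?n + 2)) = 1 / \<mu> ^ (?n + 2)"
      by (metis power_mult power_one_over)
    have pos: "0 < E * ?w / (4 * (64 * pi) ^ ?n) * \<mu> ^ (?n + 2)" using E \<mu> w by simp
    have "A \<le> (LINT x:cball x0 r|lborel. (cmod (F x))\<^sup>2) / (E * ?w / (4 * (64 * pi) ^ ?n) * \<mu> ^ (?n + 2))"
      using le pos by (subst pos_le_divide_eq) (auto simp: mult.commute)
    also have "\<dots> = 4 * (64 * pi) ^ ?n / (E * ?w) * (1 / \<mu> ^ (?n + 2)) * (LINT x:cball x0 r|lborel. (cmod (F x))\<^sup>2)"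
      by simp
    finally show ?thesis unfolding inv uF by simp
  qed
qed

section \<open>Choice of the parameters\<close>

lemma le_exp_self: "x \<le> exp (x::real)"
  using exp_ge_add_one_self[of x] by linarith

text \<open>
  The first factor is the price \<open>(1/\<mu>) ^ (n + 2)\<close> for \<open>\<eta> = (1/s) ^ n\<close>. As \<open>4 \<le> exp 2\<close>, the logarithm of the
  left-hand side is at most \<open>(n + 3) (n + 8) s exp (66 D s)\<close>, hence at most \<open>exp (c D s)\<close> with
  \<open>c = (n + 3) (n + 8) + 66\<close>, and \<open>c D < s\<close>.
\<close>
lemma double_exponential_bound:
  fixes s D :: real
  assumes s: "s \<ge> 1" and D: "D \<ge> 1" and large: "(real ((n + 3) * (n + 8)) + 66) * D < s"
    and J: "real J \<le> 33 * D * s"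
  shows "(8 * s ^ n) ^ (4 ^ J * (n + 2)) * s \<le> exp (exp (s\<^sup>2))"
proof -
  let ?e = "exp (66 * D * s)"
  have "8 \<le> exp (8 * s)" using exp_ge_add_one_self[of "8 * s"] s by linarith
  moreover have "s ^ n \<le> exp s ^ n" using s exp_ge_add_one_self[of s] by (intro power_mono) linarith+
  ultimately have "8 * s ^ n \<le> exp (8 * s) * exp s ^ n" using s by (intro mult_mono) auto
  also have "\<dots> = exp (real (n + 8) * s)"
    by (simp add: exp_of_nat_mult[symmetric] exp_add[symmetric] algebra_simps)
  finally have base: "8 * s ^ n \<le> exp (real (n + 8) * s)" .
  have "(4::real) \<le> exp 2" using exp_lower_Taylor_quadratic[of 2] by simp
  then have "(4::real) ^ J \<le> exp 2 ^ J" by (intro power_mono) auto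
  also have "\<dots> = exp (2 * real J)" by (simp add: exp_of_nat_mult[symmetric] mult.commute)
  also have "\<dots> \<le> ?e" using J by simp
  finally have J4: "(4::real) ^ J \<le> ?e" .
  have "(8 * s ^ n) ^ (4 ^ J * (n + 2)) \<le> exp (real (n + 8) * s) ^ (4 ^ J * (n + 2))"
    using base s by (intro power_mono) auto
  also have "\<dots> = exp (4 ^ J * real (n + 2) * (real (n + 8) * s))"
    by (simp add: exp_of_nat_mult[symmetric] algebra_simps)
  also have "\<dots> \<le> exp (?e * real (n + 2) * (real (n + 8) * s))"
    using J4 s by (intro iffD2[OF exp_le_cancel_iff] mult_right_mono) auto
  finally have 1: "(8 * s ^ n) ^ (4 ^ J * (n + 2)) \<le> exp (?e * real (n + 2) * (real (n + 8) * s))" .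
  have "s \<le> exp s" using exp_ge_add_one_self[of s] by linarith
  also have "\<dots> \<le> exp (?e * (real (n + 8) * s))"
  proof -
    have "1 \<le> ?e" using s D by simp
    moreover have "s \<le> real (n + 8) * s" using s by simp
    ultimately have "1 * s \<le> ?e * (real (n + 8) * s)" using s by (intro mult_mono) auto
    then show ?thesis by simp
  qed
  finally have "(8 * s ^ n) ^ (4 ^ J * (n + 2)) * s
      \<le> exp (?e * real (n + 2) * (real (n + 8) * s)) * exp (?e * (real (n + 8) * s))"
    using 1 s by (intro mult_mono) auto
  also have "\<dots> = exp (?e * (real ((n + 3) * (n + 8)) * s))"
    by (simp add: exp_add[symmetric] algebra_simps)
  also have "\<dots> \<le> exp (?e * exp (real ((n + 3) * (n + 8)) * s))"
    by (intro iffD2[OF exp_le_cancel_iff] mult_left_mono le_exp_self) simp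
  also have "\<dots> \<le> exp (exp (s\<^sup>2))"
  proof -
    have "real ((n + 3) * (n + 8)) * s * 1 \<le> real ((n + 3) * (n + 8)) * s * D"
      using s D by (intro mult_left_mono) auto
    then have "66 * D * s + real ((n + 3) * (n + 8)) * s \<le> (real ((n + 3) * (n + 8)) + 66) * D * s"
      by (simp add: algebra_simps)
    also have "\<dots> \<le> s * s" using large s by (intro mult_right_mono) auto
    finally have "66 * D * s + real ((n + 3) * (n + 8)) * s \<le> s\<^sup>2" by (simp add: power2_eq_square)
    then show ?thesis by (simp add: exp_add[symmetric])
  qed
  finally show ?thesis .
qed

text \<open>
  From \<open>K powr D \<ge> exp D \<ge> D\<close>: the observability constant dominates every exponential \<open>exp (c D)\<close>
  with \<open>c \<le> K\<close>, which covers all constants that occur.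
\<close>
lemma exp_powr_ge:
  fixes K D :: real
  assumes K: "K \<ge> 3" and D: "D \<ge> 1"
  shows "exp (K * D) \<le> exp (K powr (1 + D))"
proof -
  have "D \<le> exp D" using exp_ge_add_one_self[of D] by linarith
  also have "\<dots> = exp 1 powr D" by (simp add: powr_def)
  also have "\<dots> \<le> K powr D" using K D exp_le by (intro powr_mono2) auto
  finally have "K * D \<le> K * K powr D" using K by (intro mult_left_mono) auto
  also have "\<dots> = K powr (1 + D)" using K by (simp add: powr_add)
  finally show ?thesis by simp
qed

lemma polynomial_le_exp:
  fixes c D :: real
  assumes c: "c \<ge> 0" and D: "D \<ge> 1"
  shows "c * D ^ n + 8 + 4 * D\<^sup>2 \<le> exp ((c + real n + 14) * D)"
proof -
  have "D ^ n \<le> D ^ (n + 2)" using D by (intro power_increasing) simp_all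
  moreover have "D\<^sup>2 \<le> D ^ (n + 2)" using D by (intro power_increasing) simp_all
  moreover have "1 \<le> D ^ (n + 2)" using D by (rule one_le_power)
  ultimately have "c * D ^ n + 8 + 4 * D\<^sup>2 \<le> c * D ^ (n + 2) + 8 * D ^ (n + 2) + 4 * D ^ (n + 2)"
    using c by (intro add_mono mult_left_mono) auto
  also have "\<dots> = (c + 12) * D ^ (n + 2)" by (simp add: algebra_simps)
  also have "\<dots> \<le> exp ((c + 12) * D) * exp D ^ (n + 2)"
  proof (intro mult_mono power_mono)
    have "c + 12 \<le> (c + 12) * D" using c D mult_left_mono[of 1 D "c + 12"] by simp
    then show "c + 12 \<le> exp ((c + 12) * D)" using le_exp_self by (rule order_trans)
    show "D \<le> exp D" by (rule le_exp_self)
  qed (use D in auto)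
  also have "\<dots> = exp ((c + real n + 14) * D)"
    by (simp only: exp_of_nat_mult[symmetric] exp_add[symmetric]) (simp add: algebra_simps)
  finally show ?thesis .
qed

theorem theorem1p6:
  shows "\<exists>K>0. \<forall>(x0::real^'n) r a T u0 \<epsilon>.
    r > 0 \<longrightarrow> a > 0 \<longrightarrow> T > 0 \<longrightarrow> u0 \<in> test_functions \<longrightarrow> 0 < \<epsilon> \<longrightarrow> \<epsilon> < 1 \<longrightarrow>
    (\<integral>x. (cmod (u0 x))\<^sup>2 \<partial>lborel) \<le>
      obs_const K x0 r a T *
        (\<epsilon> * ((\<integral>x. exp (a * norm x) * (cmod (u0 x))\<^sup>2 \<partial>lborel)
               + (sobolev_norm (CARD('n) + 3) u0)\<^sup>2)
         + \<epsilon> * exp (exp (1 / \<epsilon>\<^sup>2))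
           * (LINT x:cball x0 r|lborel. (cmod (schroedinger_group T u0 x))\<^sup>2))"
proof -
  let ?n = "CARD('n)"
  let ?w = "unit_ball_vol (real ?n)"
  \<comment> \<open>Adding 1 makes \<open>E\<close> positive without computing the integral.\<close>
  define E where "E = (\<integral>y. exp (- norm y) \<partial>(lborel :: (real^'n) measure)) + 1"
  have "0 \<le> (\<integral>y. exp (- norm y) \<partial>(lborel :: (real^'n) measure))"
    by (intro integral_nonneg_AE AE_I2) simp
  then have E: "(\<integral>y. exp (- norm y) \<partial>(lborel :: (real^'n) measure)) \<le> E" "E > 0"
    unfolding E_def by linarith+
  define c1 where "c1 = 4 * (64 * pi) ^ ?n / (E * ?w)"
  define c2 where "c2 = E * ?w"
  \<comment> \<open>Once \<open>1/\<epsilon>\<close> exceeds \<open>\<beta> D\<close>, the double exponential absorbs the price of propagation; \<open>c1\<close> and \<open>c2\<close> are the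
      dimensional constants in the two alternatives of the dichotomy.\<close>
  define \<beta> where "\<beta> = real ((?n + 3) * (?n + 8)) + 66"
  define K where "K = \<beta> + c1 + c2 + real ?n + 17"
  have c: "c1 \<ge> 0" "c2 \<ge> 0" "\<beta> \<ge> 66" using E by (auto simp: c1_def c2_def \<beta>_def)
  then have K: "K \<ge> 3" "K \<ge> \<beta>" "K \<ge> c1" "K \<ge> c2 + real ?n + 14" by (auto simp: K_def)
  show ?thesis
  proof (intro exI[of _ K] conjI allI impI)
    show "K > 0" using K by simp
    fix x0 :: "real^'n" and r a T :: real and u0 :: "real^'n \<Rightarrow> complex" and \<epsilon> :: real
    assume r: "r > 0" and a: "a > 0" and T: "T > 0" and u0: "u0 \<in> test_functions"
      and \<epsilon>: "0 < \<epsilon>" "\<epsilon> < 1"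
    \<comment> \<open>Replacing \<open>a\<close> by \<open>a' \<le> a\<close> arranges \<open>a' T = d \<le> r\<close> without changing \<open>min (a T) r\<close>.\<close>
    define d where "d = min (a * T) r"
    define a' where "a' = d / T"
    define D where "D = (norm x0 + r + 1) / d"
    define s where "s = 1 / \<epsilon>"
    define P where "P = (1 + T) ^ (2 * ?n + 6)"
    define Q where "Q = exp (K powr (1 + D))"
    define L where "L = (\<integral>x. (cmod (u0 x))\<^sup>2 \<partial>lborel)"
    define A where "A = (\<integral>x. exp (a * norm x) * (cmod (u0 x))\<^sup>2 \<partial>lborel)"
    define A' where "A' = (\<integral>x. exp (a' * norm x) * (cmod (u0 x))\<^sup>2 \<partial>lborel)"
    define S where "S = (sobolev_norm (?n + 3) u0)\<^sup>2"
    define B where "B = (LINT x:cball x0 r|lborel. (cmod (schroedinger_group T u0 x))\<^sup>2)"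
    define X where "X = exp (exp (1 / \<epsilon>\<^sup>2))"
    have d: "d > 0" "d \<le> a * T" "d \<le> r" using a T r by (auto simp: d_def)
    have a': "a' > 0" "a' * T = d" "a' \<le> a" using d T by (auto simp: a'_def field_simps)
    have s: "s > 1" "1 / s = \<epsilon>" using \<epsilon> by (auto simp: s_def)
    have D: "D \<ge> 1" "1 / d \<le> D" "(norm x0 + 1) / d \<le> D"
    proof -
      have "d \<le> norm x0 + r + 1" using d(3) norm_ge_zero[of x0] by linarith
      then show "D \<ge> 1" using d by (simp add: D_def)
      show "1 / d \<le> D" "(norm x0 + 1) / d \<le> D"
        unfolding D_def using d r by (auto intro!: divide_right_mono)
    qed
    have P: "P \<ge> 1" "T\<^sup>2 \<le> P"
    proof -
      show "P \<ge> 1" using T by (simp add: P_def one_le_power)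
      have "T\<^sup>2 \<le> (1 + T)\<^sup>2" using T by (intro power_mono) auto
      also have "\<dots> \<le> P" unfolding P_def using T by (intro power_increasing) auto
      finally show "T\<^sup>2 \<le> P" .
    qed
    have KD: "exp (K * D) \<le> Q" unfolding Q_def by (rule exp_powr_ge[OF K(1) D(1)])
    have KD1: "K * D \<le> exp (K * D)" using exp_ge_add_one_self[of "K * D"] by linarith
    have Q: "\<beta> * D \<le> Q" "c1 \<le> Q" "c2 * D ^ ?n + 8 + 4 * D\<^sup>2 \<le> Q"
    proof -
      have "\<beta> * D \<le> K * D" using K D by (intro mult_right_mono) auto
      then show "\<beta> * D \<le> Q" using KD KD1 by linarith
      have "K * 1 \<le> K * D" using K D by (intro mult_left_mono) auto
      then show "c1 \<le> Q" using KD KD1 K by linarith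
      have "(c2 + real ?n + 14) * D \<le> K * D" using K D by (intro mult_right_mono) auto
      then have "exp ((c2 + real ?n + 14) * D) \<le> exp (K * D)" by simp
      with polynomial_le_exp[OF c(2) D(1), of ?n] show "c2 * D ^ ?n + 8 + 4 * D\<^sup>2 \<le> Q"
        using KD by linarith
    qed
    have Q1: "Q \<ge> 1" using c D mult_mono[of 1 \<beta> 1 D] Q(1) by auto
    note fc = C1_compactD(1)[OF test_function_C1_compact[OF u0]]
    have iA: "integrable lborel (\<lambda>x. exp (b * norm x) * (cmod (u0 x))\<^sup>2)" for b
      by (intro compactly_supported_integrable_weighted(1) fc continuous_intros)
    have LA': "L \<le> A'" unfolding L_def A'_def
    proof (rule integral_mono[OF _ iA])
      show "integrable lborel (\<lambda>x. (cmod (u0 x))\<^sup>2)" using iA[of 0] by simp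
      show "(cmod (u0 x))\<^sup>2 \<le> exp (a' * norm x) * (cmod (u0 x))\<^sup>2" for x
        using a' mult_right_mono[of 1 "exp (a' * norm x)" "(cmod (u0 x))\<^sup>2"] by simp
    qed
    have A'A: "A' \<le> A" unfolding A_def A'_def
      by (rule integral_mono[OF iA iA]) (use a' in \<open>auto intro!: mult_right_mono\<close>)
    have nonneg: "0 \<le> A" "0 \<le> A'" "0 \<le> S" "0 \<le> B"
      unfolding A_def A'_def S_def B_def set_lebesgue_integral_def
      by (auto intro!: integral_nonneg_AE AE_I2)
    have "L \<le> P * Q * (\<epsilon> * (A + S)) \<or> L \<le> P * Q * (\<epsilon> * X * B)"
    proof (cases "s \<le> \<beta> * D")
      case True
      \<comment> \<open>Here \<open>\<epsilon> \<ge> 1/(\<beta> D)\<close>, and the weighted integral alone bounds the mass.\<close>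
      have "L \<le> A" using LA' A'A by simp
      also have "A = s * (\<epsilon> * A)" using \<epsilon> by (simp add: s_def)
      also have "\<dots> \<le> Q * (\<epsilon> * A)" using True Q(1) \<epsilon> nonneg by (intro mult_right_mono) auto
      also have "\<dots> \<le> P * Q * (\<epsilon> * (A + S))"
        using P Q1 \<epsilon> nonneg mult_right_mono[of 1 P Q] by (intro mult_mono) auto
      finally show ?thesis ..
    next
      case False
      \<comment> \<open>\<open>\<eta> = \<epsilon>\<^sup>n\<close> compensates the volume of the ball of radius \<open>1/\<epsilon>\<close>: \<open>\<eta>\<^sup>2 \<epsilon>\<^sup>-\<^sup>n = \<epsilon>\<^sup>n \<le> \<epsilon>\<close>.\<close>
      define \<eta> where "\<eta> = \<epsilon> ^ ?n"
      \<comment> \<open>The number of steps of length \<open>d/32\<close> that lead from \<open>x\<^sub>0\<close> across the ball of radius \<open>s = 1/\<epsilon>\<close> around 0.\<close>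
      define J where "J = nat \<lceil>32 * (norm x0 + s) / d\<rceil>"
      have \<eta>: "0 < \<eta>" "\<eta> \<le> 1" using \<epsilon> by (auto simp: \<eta>_def intro!: power_le_one)
      have Jge: "32 * (norm x0 + s) / d \<le> real J" unfolding J_def by linarith
      have quot_nonneg: "0 \<le> 32 * (norm x0 + s) / d" using s d by (intro divide_nonneg_pos) auto
      have Jle: "real J \<le> 32 * (norm x0 + s) / d + 1" unfolding J_def using quot_nonneg by linarith
      have J: "norm x0 + s \<le> real (Suc J) * (a' * T / 32)"
      proof -
        have "norm x0 + s \<le> real J * (d / 32)" using Jge d by (simp add: field_simps)
        also have "\<dots> \<le> real (Suc J) * (d / 32)" using d by (intro mult_right_mono) auto
        finally show ?thesis by (simp add: a')
      qed
      have J33: "real J \<le> 33 * D * s"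
      proof -
        have "norm x0 + s \<le> (norm x0 + 1) * s"
          using s mult_left_mono[of 1 s "norm x0"] by (simp add: algebra_simps)
        then have "(norm x0 + s) / d \<le> (norm x0 + 1) * s / d" using d by (intro divide_right_mono) auto
        also have "\<dots> = (norm x0 + 1) / d * s" by simp
        also have "\<dots> \<le> D * s" using D s by (intro mult_right_mono) auto
        finally have "32 * ((norm x0 + s) / d) \<le> 32 * (D * s)" by (intro mult_left_mono) auto
        moreover have "32 * (norm x0 + s) / d = 32 * ((norm x0 + s) / d)" by simp
        moreover have "1 \<le> D * s" using D s mult_mono[of 1 D 1 s] by simp
        ultimately show ?thesis using Jle by linarith
      qed
      have "0 < s" using s by simp
      have Sk: "Suc (?n + 2) = ?n + 3" by simp
      from schroedinger_dichotomy[OF u0 T a'(1) _ \<open>0 < s\<close> \<eta> J E, of r "?n + 2", folded A'_def L_def B_def, unfolded Sk, folded S_def]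
      have "L \<le> \<eta>\<^sup>2 * E * ?w * (s / (2 * pi * d)) ^ ?n * A' + (8 * T\<^sup>2 * S + 4 / a'\<^sup>2 * A') / s\<^sup>2
         \<or> A' \<le> c1 * (8 / \<eta>) ^ (4 ^ J * (?n + 2)) * B"
        using d unfolding a' c1_def by blast
      then show ?thesis
      proof
        assume "A' \<le> c1 * (8 / \<eta>) ^ (4 ^ J * (?n + 2)) * B"
        also have "8 / \<eta> = 8 * s ^ ?n" by (simp add: \<eta>_def s_def power_one_over)
        also have "c1 * (8 * s ^ ?n) ^ (4 ^ J * (?n + 2)) * B \<le> Q * (\<epsilon> * X) * B"
        proof (intro mult_right_mono mult_mono)
          have "(8 * s ^ ?n) ^ (4 ^ J * (?n + 2)) * s \<le> exp (exp (s\<^sup>2))"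
            by (rule double_exponential_bound) (use s D False J33 in \<open>auto simp: \<beta>_def not_le\<close>)
          then show "(8 * s ^ ?n) ^ (4 ^ J * (?n + 2)) \<le> \<epsilon> * X"
            using \<epsilon> by (simp add: s_def X_def field_simps power_one_over)
        qed (use Q Q1 c s nonneg in auto)
        also have "\<dots> \<le> P * Q * (\<epsilon> * X * B)"
          using P Q1 \<epsilon> nonneg mult_right_mono[of 1 P "Q * (\<epsilon> * X * B)"] by (simp add: X_def mult.assoc)
        finally show ?thesis using LA' by linarith
      next
        assume le: "L \<le> \<eta>\<^sup>2 * E * ?w * (s / (2 * pi * d)) ^ ?n * A' + (8 * T\<^sup>2 * S + 4 / a'\<^sup>2 * A') / s\<^sup>2"
        have "\<eta>\<^sup>2 * (s / (2 * pi * d)) ^ ?n \<le> \<epsilon> * D ^ ?n"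
        proof -
          have "\<eta>\<^sup>2 * s ^ ?n = \<epsilon> ^ ?n" using \<epsilon> by (simp add: \<eta>_def s_def power2_eq_square power_one_over)
          also have "\<dots> \<le> \<epsilon> ^ 1" using \<epsilon> by (intro power_decreasing) (auto simp: Suc_le_eq)
          finally have 1: "\<eta>\<^sup>2 * s ^ ?n \<le> \<epsilon>" by simp
          have "1 / (2 * pi * d) \<le> 1 / d" using d pi_gt3 by (intro divide_left_mono) auto
          then have "(1 / (2 * pi * d)) ^ ?n \<le> D ^ ?n" using D d by (intro power_mono) auto
          with 1 have "\<eta>\<^sup>2 * s ^ ?n * (1 / (2 * pi * d)) ^ ?n \<le> \<epsilon> * D ^ ?n"
            using \<epsilon> d by (intro mult_mono) auto
          then show ?thesis by (simp add: power_divide)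
        qed
        then have "c2 * (\<eta>\<^sup>2 * (s / (2 * pi * d)) ^ ?n) * A' \<le> c2 * (\<epsilon> * D ^ ?n) * A"
          by (rule mult_mono[OF mult_left_mono[OF _ c(2)] A'A]) (use c nonneg \<epsilon> D in auto)
        then have 1: "\<eta>\<^sup>2 * E * ?w * (s / (2 * pi * d)) ^ ?n * A' \<le> \<epsilon> * (c2 * D ^ ?n * A)"
          by (simp add: c2_def mult_ac)
        have "4 / a'\<^sup>2 = 4 * T\<^sup>2 * (1 / d)\<^sup>2" by (simp add: a'_def power_divide)
        also have "\<dots> \<le> 4 * T\<^sup>2 * D\<^sup>2" using D d by (intro mult_left_mono power_mono) auto
        finally have "4 / a'\<^sup>2 * A' \<le> 4 * T\<^sup>2 * D\<^sup>2 * A" using nonneg A'A by (intro mult_mono) auto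
        then have "(8 * T\<^sup>2 * S + 4 / a'\<^sup>2 * A') / s\<^sup>2 \<le> (8 * T\<^sup>2 * S + 4 * T\<^sup>2 * D\<^sup>2 * A) / s\<^sup>2"
          by (intro divide_right_mono) auto
        also have "\<dots> = \<epsilon>\<^sup>2 * (T\<^sup>2 * (8 * S + 4 * D\<^sup>2 * A))" by (simp add: s_def power_one_over algebra_simps)
        also have "\<dots> \<le> \<epsilon> * (P * (8 * S + 4 * D\<^sup>2 * A))"
          using \<epsilon> P nonneg power_decreasing[of 1 2 \<epsilon>] by (intro mult_mono) auto
        finally have 2: "(8 * T\<^sup>2 * S + 4 / a'\<^sup>2 * A') / s\<^sup>2 \<le> \<epsilon> * (P * (8 * S + 4 * D\<^sup>2 * A))" .
        have "\<epsilon> * (c2 * D ^ ?n * A) \<le> \<epsilon> * (P * (c2 * D ^ ?n * A))"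
          using \<epsilon> P c D nonneg mult_right_mono[of 1 P "c2 * D ^ ?n * A"] by (intro mult_left_mono) auto
        with le 1 2 have "L \<le> \<epsilon> * (P * (c2 * D ^ ?n * A)) + \<epsilon> * (P * (8 * S + 4 * D\<^sup>2 * A))" by linarith
        also have "\<dots> = \<epsilon> * P * (c2 * D ^ ?n * A + 8 * S + 4 * D\<^sup>2 * A)" by (simp add: algebra_simps)
        also have "\<dots> \<le> \<epsilon> * P * ((c2 * D ^ ?n + 8 + 4 * D\<^sup>2) * (A + S))"
          using \<epsilon> P c D nonneg by (intro mult_left_mono) (auto simp: algebra_simps)
        also have "\<dots> \<le> \<epsilon> * P * (Q * (A + S))"
          using \<epsilon> P Q nonneg by (intro mult_left_mono mult_right_mono) auto
        also have "\<dots> = P * Q * (\<epsilon> * (A + S))" by (simp add: algebra_simps)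
        finally show ?thesis ..
      qed
    qed
    moreover have "0 \<le> P * Q * (\<epsilon> * (A + S))" "0 \<le> P * Q * (\<epsilon> * X * B)"
      using P Q1 \<epsilon> nonneg by (auto simp: X_def)
    ultimately have "L \<le> P * Q * (\<epsilon> * (A + S) + \<epsilon> * X * B)" by (auto simp: distrib_left)
    moreover have "obs_const K x0 r a T = P * Q"
      by (simp add: obs_const_def P_def Q_def D_def d_def)
    ultimately show "(\<integral>x. (cmod (u0 x))\<^sup>2 \<partial>lborel) \<le>
      obs_const K x0 r a T *
        (\<epsilon> * ((\<integral>x. exp (a * norm x) * (cmod (u0 x))\<^sup>2 \<partial>lborel)
               + (sobolev_norm (CARD('n) + 3) u0)\<^sup>2)
         + \<epsilon> * exp (exp (1 / \<epsilon>\<^sup>2))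
           * (LINT x:cball x0 r|lborel. (cmod (schroedinger_group T u0 x))\<^sup>2))"
      unfolding L_def A_def S_def X_def B_def by simp
  qed
qed

end
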